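(* (1) OGSL is invariant under decision-unwinding, and (2) OGSL has the decision-tree model property. That is, for every OGSL sentence $\varphi$ and every CGS $\mathcal{G}$ with decision-unwinding $\mathcal{G}_{DU}$, $\mathcal{G}\models\varphi$ if and only if $\mathcal{G}_{DU}\models\varphi$.
   Context: A concurrent game structure (CGS) is a tuple $\mathcal{G}=(\mathrm{AP},\mathrm{Ag},\mathrm{Ac},\mathrm{St},\lambda,\tau,s_0)$ with $\mathrm{AP},\mathrm{Ag}$ finite non-empty, $\mathrm{Ac},\mathrm{St}$ countable non-empty, $s_0\in\mathrm{St}$, $\lambda:\mathrm{St}\to2^{\mathrm{AP}}$, $\tau:\mathrm{St}\times\mathrm{Dc}\to\mathrm{St}$, where $\mathrm{Dc}=\mathrm{Ac}^{\mathrm{Ag}}$ (decisions). Tracks are non-empty finite state sequences with each consecutive pair related by $\tau$ under some decision; strategies are partial maps from tracks to actions ($s$-total if defined exactly on tracks starting at $s$); assignments are partial maps from $\mathrm{Var}\cup\mathrm{Ag}$ to strategies. For a complete (defined on all agents) $s$-total assignment $\chi$, the play from $s$ is $\pi_0=s$, $\pi_{i+1}=\tau(\pi_i,d_i)$ with $d_i(a)=\chi(a)(\pi_0\cdots\pi_i)$; $(\chi,s)^i=(\chi_{\pi_0\cdots\pi_i},\pi_i)$ where each strategy $f$ is translated to $f_\rho(\mathrm{last}(\rho)\cdot\rho')=f(\rho\cdot\rho')$. SL formulas: $\varphi::=p\mid\neg\varphi\mid\varphi\wedge\varphi\mid\varphi\vee\varphi\mid X\varphi\mid\varphi U\varphi\mid\varphi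 R\varphi\mid\langle\langle x\rangle\rangle\varphi\mid[[x]]\varphi\mid(a,x)\varphi$. Semantics: $\langle\langle x\rangle\rangle\varphi$ (resp. $[[x]]\varphi$) holds at $s$ under $\chi$ iff for some (resp. every) $s$-total strategy $f$, $\varphi$ holds under $\chi[x\mapsto f]$; $(a,x)\varphi$ holds iff $\varphi$ holds under $\chi[a\mapsto\chi(x)]$; with complete $\chi$, $X\varphi$, $\varphi_1U\varphi_2$, $\varphi_1R\varphi_2$ are evaluated as in LTL along the sequence $(\chi,s)^0,(\chi,s)^1,\ldots$. A sentence has no free agents (agents not bound before a temporal operator) and no free variables (bound but unquantified). $\mathcal{G}\models\varphi$ iff $\varphi$ holds at $s_0$ under the empty assignment. OGSL: a quantification prefix is a word over $\{\langle\langle x\rangle\rangle,[[x]]\}$ listing each variable of a finite set exactly once; a binding prefix is a word $(a_1,x_1)\cdots$ in which every agent occurs exactly once. OGSL formulas: $\varphi::=p\mid\neg\varphi\mid\varphi\wedge\varphi\mid\varphi\vee\varphi\mid X\varphi\mid\varphi U\varphi\mid\varphi R\varphi\mid\wp\flat\varphi$ where $\flat$ is a binding prefix and $\wp$ is a quantification prefix over exactly the free variables of $\flat\varphi$. An OGSL sentence is an OGSL formula that is an SL sentence. A decision tree (DT) is a CGS $(\mathrm{AP},\mathrm{Ag},\mathrm{Ac},\mathrm{Dc}^*,\lambda,\tau,\varepsilon)$ with $\tau(t,d)=t\cdot d$. The decision-unwinding of a CGS $\mathcal{G}$ is the DT $\mathcal{G}_{DU}=(\mathrm{AP},\mathrm{Ag},\mathrm{Ac}_{\mathcal{G}},\mathrm{Dc}_{\mathcal{G}}^*,\lambda,\tau,\varepsilon)$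 for which there is a surjective $\mathrm{unw}:\mathrm{Dc}_{\mathcal{G}}^*\to\mathrm{St}_{\mathcal{G}}$ with $\mathrm{unw}(\varepsilon)=s_{0}$, $\mathrm{unw}(\tau(t,d))=\tau_{\mathcal{G}}(\mathrm{unw}(t),d)$ and $\lambda(t)=\lambda_{\mathcal{G}}(\mathrm{unw}(t))$. A logic is invariant under decision-unwinding / a sentence has the decision-tree model property if, for each CGS $\mathcal{G}$, $\mathcal{G}\models\varphi$ iff $\mathcal{G}_{DU}\models\varphi$. *)

theory Defs
  imports "HOL-Library.Countable"
begin

(* The sets AP, Ag, Ac and St of a CGS are rendered as types, the sort constraints
   recording finiteness and countability (types are non-empty). *)

type_synonym ('ag, 'ac) decision = "'ag \<Rightarrow> 'ac"

record ('ap::finite, 'ag::finite, 'ac::countable, 'st::countable) cgs =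
  label :: "'st \<Rightarrow> 'ap set"
  step :: "'st \<Rightarrow> ('ag, 'ac) decision \<Rightarrow> 'st"
  init :: 'st

definition track :: "('ap::finite, 'ag::finite, 'ac::countable, 'st::countable) cgs \<Rightarrow> 'st list \<Rightarrow> bool" where
  "track G \<rho> \<longleftrightarrow> \<rho> \<noteq> [] \<and> (\<forall>i. Suc i < length \<rho> \<longrightarrow> (\<exists>d. \<rho> ! Suc i = step G (\<rho> ! i) d))"

type_synonym ('ac, 'st) strategy = "'st list \<rightharpoonup> 'ac"

definition total_strategy ::
  "('ap::finite, 'ag::finite, 'ac::countable, 'st::countable) cgs \<Rightarrow> 'st \<Rightarrow> ('ac, 'st) strategy \<Rightarrow> bool" where
  "total_strategy G s f \<longleftrightarrow> dom f = {\<rho>. track G \<rho> \<and> hd \<rho> = s}"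

(* Inl x is the variable x, Inr a the agent a. *)
type_synonym ('v, 'ag, 'ac, 'st) assignment = "'v + 'ag \<rightharpoonup> ('ac, 'st) strategy"

definition complete :: "('v, 'ag, 'ac, 'st) assignment \<Rightarrow> bool" where
  "complete \<chi> \<longleftrightarrow> range Inr \<subseteq> dom \<chi>"

definition translate_strategy :: "'st list \<Rightarrow> ('ac, 'st) strategy \<Rightarrow> ('ac, 'st) strategy" where
  "translate_strategy \<rho> f =
     (\<lambda>\<sigma>. if \<sigma> \<noteq> [] \<and> hd \<sigma> = last \<rho> then f (\<rho> @ tl \<sigma>) else None)"

definition translate :: "'st list \<Rightarrow> ('v, 'ag, 'ac, 'st) assignment \<Rightarrow> ('v, 'ag, 'ac, 'st) assignment" where
  "translate \<rho> \<chi> = (\<lambda>l. map_option (translate_strategy \<rho>) (\<chi> l))"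

(* play_prefix G \<chi> s i is the track \<pi>\<^sub>0 ... \<pi>\<^sub>i of the play of a complete s-total \<chi> from s. *)
primrec play_prefix ::
  "('ap::finite, 'ag::finite, 'ac::countable, 'st::countable) cgs \<Rightarrow> ('v, 'ag, 'ac, 'st) assignment
     \<Rightarrow> 'st \<Rightarrow> nat \<Rightarrow> 'st list" where
  "play_prefix G \<chi> s 0 = [s]"
| "play_prefix G \<chi> s (Suc i) =
     (let \<rho> = play_prefix G \<chi> s i
      in \<rho> @ [step G (last \<rho>) (\<lambda>a. the (the (\<chi> (Inr a)) \<rho>))])"

datatype ('ap, 'ag, 'v) sl =
    Atom 'ap
  | Neg "('ap, 'ag, 'v) sl"
  | Conj "('ap, 'ag, 'v) sl" "('ap, 'ag, 'v) sl"
  | Disj "('ap, 'ag, 'v) sl" "('ap, 'ag, 'v) sl"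
  | Next "('ap, 'ag, 'v) sl"
  | Until "('ap, 'ag, 'v) sl" "('ap, 'ag, 'v) sl"
  | Release "('ap, 'ag, 'v) sl" "('ap, 'ag, 'v) sl"
  | ExStr 'v "('ap, 'ag, 'v) sl"
  | AllStr 'v "('ap, 'ag, 'v) sl"
  | Bind 'ag 'v "('ap, 'ag, 'v) sl"

(* The informal semantics interprets temporal operators under complete assignments only;
   here they are false under incomplete ones, which evaluating a sentence never meets. *)
primrec sat ::
  "('ap::finite, 'ag::finite, 'ac::countable, 'st::countable) cgs \<Rightarrow> ('ap, 'ag, 'v) sl
     \<Rightarrow> ('v, 'ag, 'ac, 'st) assignment \<Rightarrow> 'st \<Rightarrow> bool" where
  "sat G (Atom p) \<chi> s \<longleftrightarrow> p \<in> label G s"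
| "sat G (Neg \<phi>) \<chi> s \<longleftrightarrow> \<not> sat G \<phi> \<chi> s"
| "sat G (Conj \<phi> \<psi>) \<chi> s \<longleftrightarrow> sat G \<phi> \<chi> s \<and> sat G \<psi> \<chi> s"
| "sat G (Disj \<phi> \<psi>) \<chi> s \<longleftrightarrow> sat G \<phi> \<chi> s \<or> sat G \<psi> \<chi> s"
| "sat G (Next \<phi>) \<chi> s \<longleftrightarrow> complete \<chi> \<and>
     (let \<rho> = play_prefix G \<chi> s in sat G \<phi> (translate (\<rho> 1) \<chi>) (last (\<rho> 1)))"
| "sat G (Until \<phi> \<psi>) \<chi> s \<longleftrightarrow> complete \<chi> \<and>
     (let \<rho> = play_prefix G \<chi> s in
      \<exists>i. sat G \<psi> (translate (\<rho> i) \<chi>) (last (\<rho> i)) \<and>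
          (\<forall>j<i. sat G \<phi> (translate (\<rho> j) \<chi>) (last (\<rho> j))))"
| "sat G (Release \<phi> \<psi>) \<chi> s \<longleftrightarrow> complete \<chi> \<and>
     (let \<rho> = play_prefix G \<chi> s in
      \<forall>i. sat G \<psi> (translate (\<rho> i) \<chi>) (last (\<rho> i)) \<or>
          (\<exists>j<i. sat G \<phi> (translate (\<rho> j) \<chi>) (last (\<rho> j))))"
| "sat G (ExStr x \<phi>) \<chi> s \<longleftrightarrow> (\<exists>f. total_strategy G s f \<and> sat G \<phi> (\<chi>(Inl x \<mapsto> f)) s)"
| "sat G (AllStr x \<phi>) \<chi> s \<longleftrightarrow> (\<forall>f. total_strategy G s f \<longrightarrow> sat G \<phi> (\<chi>(Inl x \<mapsto> f)) s)"
| "sat G (Bind a x \<phi>) \<chi> s \<longleftrightarrow> sat G \<phi> (\<chi>(Inr a := \<chi> (Inl x))) s"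

definition models ::
  "('ap::finite, 'ag::finite, 'ac::countable, 'st::countable) cgs \<Rightarrow> ('ap, 'ag, 'v) sl \<Rightarrow> bool"
  (infix "\<Turnstile>" 50) where
  "G \<Turnstile> \<phi> \<longleftrightarrow> sat G \<phi> Map.empty (init G)"

primrec free :: "('ap, 'ag, 'v) sl \<Rightarrow> ('v + 'ag) set" where
  "free (Atom p) = {}"
| "free (Neg \<phi>) = free \<phi>"
| "free (Conj \<phi> \<psi>) = free \<phi> \<union> free \<psi>"
| "free (Disj \<phi> \<psi>) = free \<phi> \<union> free \<psi>"
| "free (Next \<phi>) = range Inr \<union> free \<phi>"
| "free (Until \<phi> \<psi>) = range Inr \<union> free \<phi> \<union> free \<psi>"
| "free (Release \<phi> \<psi>) = range Inr \<union> free \<phi> \<union> free \<psi>"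
| "free (ExStr x \<phi>) = free \<phi> - {Inl x}"
| "free (AllStr x \<phi>) = free \<phi> - {Inl x}"
| "free (Bind a x \<phi>) =
     (if Inr a \<in> free \<phi> then insert (Inl x) (free \<phi> - {Inr a}) else free \<phi>)"

definition sentence :: "('ap, 'ag, 'v) sl \<Rightarrow> bool" where
  "sentence \<phi> \<longleftrightarrow> free \<phi> = {}"

datatype 'v quantifier = Exists (qvar: 'v) | Forall (qvar: 'v)

primrec quantify1 :: "'v quantifier \<Rightarrow> ('ap, 'ag, 'v) sl \<Rightarrow> ('ap, 'ag, 'v) sl" where
  "quantify1 (Exists x) = ExStr x"
| "quantify1 (Forall x) = AllStr x"

definition quantify :: "'v quantifier list \<Rightarrow> ('ap, 'ag, 'v) sl \<Rightarrow> ('ap, 'ag, 'v) sl" where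
  "quantify = foldr quantify1"

definition bind :: "('ag \<times> 'v) list \<Rightarrow> ('ap, 'ag, 'v) sl \<Rightarrow> ('ap, 'ag, 'v) sl" where
  "bind = foldr (\<lambda>(a, x). Bind a x)"

definition quantification_prefix :: "'v set \<Rightarrow> 'v quantifier list \<Rightarrow> bool" where
  "quantification_prefix V q \<longleftrightarrow> distinct (map qvar q) \<and> set (map qvar q) = V"

definition binding_prefix :: "('ag \<times> 'v) list \<Rightarrow> bool" where
  "binding_prefix b \<longleftrightarrow> distinct (map fst b) \<and> set (map fst b) = UNIV"

inductive ogsl :: "('ap, 'ag, 'v) sl \<Rightarrow> bool" where
  "ogsl (Atom p)"
| "ogsl \<phi> \<Longrightarrow> ogsl (Neg \<phi>)"
| "ogsl \<phi> \<Longrightarrow> ogsl \<psi> \<Longrightarrow> ogsl (Conj \<phi> \<psi>)"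
| "ogsl \<phi> \<Longrightarrow> ogsl \<psi> \<Longrightarrow> ogsl (Disj \<phi> \<psi>)"
| "ogsl \<phi> \<Longrightarrow> ogsl (Next \<phi>)"
| "ogsl \<phi> \<Longrightarrow> ogsl \<psi> \<Longrightarrow> ogsl (Until \<phi> \<psi>)"
| "ogsl \<phi> \<Longrightarrow> ogsl \<psi> \<Longrightarrow> ogsl (Release \<phi> \<psi>)"
| "ogsl \<phi> \<Longrightarrow> binding_prefix b \<Longrightarrow> quantification_prefix {x. Inl x \<in> free (bind b \<phi>)} q
     \<Longrightarrow> ogsl (quantify q (bind b \<phi>))"

definition ogsl_sentence :: "('ap, 'ag, 'v) sl \<Rightarrow> bool" where
  "ogsl_sentence \<phi> \<longleftrightarrow> ogsl \<phi> \<and> sentence \<phi>"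

definition decision_tree ::
  "('ap::finite, 'ag::finite, 'ac::countable, ('ag, 'ac) decision list) cgs \<Rightarrow> bool" where
  "decision_tree T \<longleftrightarrow> init T = [] \<and> (\<forall>t d. step T t d = t @ [d])"

definition reachable ::
  "('ap::finite, 'ag::finite, 'ac::countable, 'st::countable) cgs \<Rightarrow> 'st set" where
  "reachable G = {last \<rho> | \<rho>. track G \<rho> \<and> hd \<rho> = init G}"

definition unwinding_map ::
  "('ap::finite, 'ag::finite, 'ac::countable, 'st::countable) cgs
     \<Rightarrow> ('ap, 'ag, 'ac, ('ag, 'ac) decision list) cgs
     \<Rightarrow> (('ag, 'ac) decision list \<Rightarrow> 'st) \<Rightarrow> bool" where
  "unwinding_map G T unw \<longleftrightarrow>
     unw [] = init G \<and>
     (\<forall>t d. unw (step T t d) = step G (unw t) d) \<and>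
     (\<forall>t. label T t = label G (unw t))"

(* Surjectivity of unw is onto the reachable states: an unwinding map never meets other
   states, so surjectivity onto all states would leave out every G with an unreachable one.
   If all states are reachable the two coincide (decision_unwinding_if_surj). *)
definition decision_unwinding ::
  "('ap::finite, 'ag::finite, 'ac::countable, 'st::countable) cgs
     \<Rightarrow> ('ap, 'ag, 'ac, ('ag, 'ac) decision list) cgs \<Rightarrow> bool" where
  "decision_unwinding G T \<longleftrightarrow>
     decision_tree T \<and> (\<exists>unw. unwinding_map G T unw \<and> range unw = reachable G)"

lemma unwinding_map_range:
  assumes "decision_tree T" "unwinding_map G T unw"
  shows "range unw = reachable G"
proof -
  have unw: "unw [] = init G" "unw (t @ [d]) = step G (unw t) d" for t d
    using assms by (auto simp: decision_tree_def unwinding_map_def)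
  have "\<exists>\<rho>. track G \<rho> \<and> hd \<rho> = init G \<and> last \<rho> = unw t" for t
  proof (induction t rule: rev_induct)
    case Nil
    show ?case by (rule exI[of _ "[init G]"]) (simp add: track_def unw)
  next
    case (snoc d t)
    then obtain \<rho> where \<rho>: "track G \<rho>" "hd \<rho> = init G" "last \<rho> = unw t" by blast
    let ?\<rho> = "\<rho> @ [step G (unw t) d]"
    have "\<exists>e. ?\<rho> ! Suc i = step G (?\<rho> ! i) e" if "Suc i < length ?\<rho>" for i
    proof (cases "Suc i < length \<rho>")
      case True
      then show ?thesis using \<rho>(1) by (simp add: track_def nth_append)
    next
      case False
      with that have "Suc i = length \<rho>" by simp
      moreover from this have "\<rho> ! i = unw t"
        using \<rho> by (metis diff_Suc_1 last_conv_nth track_def)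
      ultimately show ?thesis by (auto simp: nth_append)
    qed
    with \<rho> have "track G ?\<rho>" "hd ?\<rho> = init G" "last ?\<rho> = unw (t @ [d])"
      by (simp_all add: track_def unw)
    then show ?case by blast
  qed
  moreover have "\<rho> ! i \<in> range unw"
    if \<rho>: "track G \<rho>" "hd \<rho> = init G" and i: "i < length \<rho>" for \<rho> i
    using i
  proof (induction i)
    case 0
    then show ?case using \<rho> unw(1) by (metis hd_conv_nth rangeI track_def)
  next
    case (Suc i)
    then obtain t where "\<rho> ! i = unw t" by auto
    moreover obtain d where "\<rho> ! Suc i = step G (\<rho> ! i) d"
      using \<rho>(1) Suc.prems by (auto simp: track_def)
    ultimately show ?case using unw(2) by (metis rangeI)
  qed
  then have "last \<rho> \<in> range unw" if "track G \<rho>" "hd \<rho> = init G" for \<rho>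
    using that by (simp add: last_conv_nth track_def)
  ultimately show ?thesis
    unfolding reachable_def by (intro equalityI subsetI; clarsimp) metis
qed

lemma decision_unwinding_if_surj:
  "decision_tree T \<Longrightarrow> unwinding_map G T unw \<Longrightarrow> surj unw \<Longrightarrow> decision_unwinding G T"
  unfolding decision_unwinding_def using unwinding_map_range by blast

lemma decision_unwinding_ex1:
  fixes G :: "('ap::finite, 'ag::finite, 'ac::countable, 'st::countable) cgs"
  shows "\<exists>!T. decision_unwinding G T"
proof (rule ex_ex1I)
  let ?unw = "foldl (step G) (init G)"
  let ?T = "\<lparr>label = label G \<circ> ?unw, step = \<lambda>t d. t @ [d], init = []\<rparr>"
  have "decision_tree ?T" "unwinding_map G ?T ?unw"
    by (simp_all add: decision_tree_def unwinding_map_def)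
  then show "\<exists>T. decision_unwinding G T"
    unfolding decision_unwinding_def by (metis unwinding_map_range)
next
  fix T T' assume "decision_unwinding G T" "decision_unwinding G T'"
  then obtain u u' where T: "decision_tree T" "decision_tree T'"
    and u: "unwinding_map G T u" "unwinding_map G T' u'"
    by (auto simp: decision_unwinding_def)
  have "u t = u' t" for t
    using T u by (induction t rule: rev_induct) (auto simp: decision_tree_def unwinding_map_def)
  then have "label T = label T'" using u by (simp add: unwinding_map_def fun_eq_iff)
  moreover have "step T = step T'" "init T = init T'"
    using T by (auto simp: decision_tree_def fun_eq_iff)
  ultimately show "T = T'" by simp
qed

end

(* A block of strategy quantifiers followed by a binding is turned into a game of perfect
   information in which the quantified variables choose their actions one after the other, in the
   order of the prefix. Only the sequence of states visited decides who wins, so the game for a state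
   of the decision tree and the game for its image in G have the same winner. A winning
   strategy of either player yields the truth value of the block in both structures: to play along
   tracks, which do not show the decisions taken, a player fixes for every track one representative
   history of the game that conforms to the winning strategy.
   The game must be determined, and this cannot be avoided: in the tree, a partner can signal by
   otherwise invisible actions, so invariance would fail for an undetermined winning condition. The
   winning condition is an LTL property, hence Sigma^0_3, and Davis's theorem applies. *)
theory Submission
  imports Defs "HOL-Library.Ramsey"
begin

section \<open>Determinacy of Sigma-0-3 games\<close>

text \<open>Moves of the game are actions, never states, so one strategy on action sequences can be
  used verbatim in \<open>G\<close> and in its tree; determinacy is accordingly proved for an
  arbitrary, possibly infinite type of moves. The Sigma^0_3 bound is not read off a deterministic
  automaton but comes from Ramsey's theorem. Truth along a path is computed backwards and hence
  needs a guess of what holds in the future. The guess is a set \<open>V\<close> of formulas at a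
  cut \<open>i\<close>; it is confirmed by infinitely many later cuts \<open>j\<close> such that the
  evaluation leads from \<open>V\<close> at \<open>j\<close> back to \<open>V\<close> at
  \<open>i\<close> and meets all eventualities on the way. Each confirmation is visible in a finite
  prefix, so the choice of \<open>i\<close> and \<open>V\<close> is a countable union and the
  infinitely many confirmations are a G-delta condition.\<close>

abbreviation pre :: "(nat \<Rightarrow> 'm) \<Rightarrow> nat \<Rightarrow> 'm list" where
  "pre x k \<equiv> map x [0..<k]"

lemma take_pre: "k \<le> l \<Longrightarrow> take k (pre x l) = pre x k"
  by (simp add: take_map)

lemma pre_eq_take: "pre x l = pre y l \<Longrightarrow> k \<le> l \<Longrightarrow> pre x k = pre y k"
  by (metis take_pre)

locale game =
  fixes I :: "'m list \<Rightarrow> bool"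
begin

text \<open>Subtrees arise only by restricting the moves of the second player, so strategies of player I need
  not be relativized to them.\<close>

definition quasi :: "'m list set \<Rightarrow> bool" where
  "quasi S \<longleftrightarrow> (\<forall>p\<in>S. if I p then \<forall>m. p @ [m] \<in> S else \<exists>m. p @ [m] \<in> S)"

definition paths :: "'m list \<Rightarrow> 'm list set \<Rightarrow> (nat \<Rightarrow> 'm) set" where
  "paths p S = {x. pre x (length p) = p \<and> (\<forall>k\<ge>length p. pre x k \<in> S)}"

definition conforms :: "'m list \<Rightarrow> ('m list \<Rightarrow> 'm) \<Rightarrow> (nat \<Rightarrow> 'm) \<Rightarrow> bool" where
  "conforms p \<sigma> x \<longleftrightarrow> (\<forall>k\<ge>length p. I (pre x k) \<longrightarrow> x k = \<sigma> (pre x k))"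

definition wins :: "'m list \<Rightarrow> 'm list set \<Rightarrow> (nat \<Rightarrow> 'm) set \<Rightarrow> bool" where
  "wins p S C \<longleftrightarrow> (\<exists>\<sigma>. \<forall>x\<in>paths p S. conforms p \<sigma> x \<longrightarrow> x \<in> C)"

lemma paths_snoc: "x \<in> paths p S \<Longrightarrow> x \<in> paths (p @ [x (length p)]) S"
  by (auto simp: paths_def)

lemma paths_pre: "x \<in> paths p S \<Longrightarrow> length p \<le> k \<Longrightarrow> x \<in> paths (pre x k) S"
  by (auto simp: paths_def)

lemma wins_move_I:
  assumes "I p" "wins (p @ [m]) S C"
  shows "wins p S C"
proof -
  obtain \<sigma> where \<sigma>: "\<And>x. x \<in> paths (p @ [m]) S \<Longrightarrow> conforms (p @ [m]) \<sigma> x \<Longrightarrow> x \<in> C"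
    using assms(2) unfolding wins_def by blast
  have "x \<in> C" if x: "x \<in> paths p S" "conforms p (\<sigma>(p := m)) x" for x
  proof (rule \<sigma>)
    have p: "pre x (length p) = p" using x(1) by (simp add: paths_def)
    with x(2) assms(1) have "x (length p) = m" unfolding conforms_def by fastforce
    with paths_snoc[OF x(1)] show "x \<in> paths (p @ [m]) S" by simp
    have "pre x k \<noteq> p" if "k \<ge> Suc (length p)" for k
      using that by (metis Suc_n_not_le_n length_map length_upt minus_nat.diff_0)
    with x(2) show "conforms (p @ [m]) \<sigma> x" unfolding conforms_def by simp
  qed
  then show ?thesis unfolding wins_def by blast
qed

text \<open>The history records at index \<open>length p\<close> which successor was entered, so the
  strategies for all successors can be merged into one.\<close>

lemma wins_move_II:
  assumes "\<And>m. p @ [m] \<in> S \<Longrightarrow> wins (p @ [m]) S C"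
  shows "wins p S C"
proof -
  obtain \<sigma> where \<sigma>: "\<And>m x. p @ [m] \<in> S \<Longrightarrow> x \<in> paths (p @ [m]) S
      \<Longrightarrow> conforms (p @ [m]) (\<sigma> m) x \<Longrightarrow> x \<in> C"
    using assms unfolding wins_def by metis
  have "x \<in> C" if x: "x \<in> paths p S" "conforms p (\<lambda>u. \<sigma> (u ! length p) u) x" for x
  proof (rule \<sigma>)
    show "x \<in> paths (p @ [x (length p)]) S" by (rule paths_snoc[OF x(1)])
    then show "p @ [x (length p)] \<in> S" by (auto simp: paths_def)
    show "conforms (p @ [x (length p)]) (\<sigma> (x (length p))) x"
      using x(2) unfolding conforms_def by simp
  qed
  then show ?thesis unfolding wins_def by blast
qed

section \<open>Positions at which player I does not win\<close>

definition nonlosing :: "'m list set \<Rightarrow> (nat \<Rightarrow> 'm) set \<Rightarrow> 'm list set" where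
  "nonlosing S C = {p \<in> S. \<not> wins p S C}"

lemma quasi_nonlosing: "quasi S \<Longrightarrow> quasi (nonlosing S C)"
  unfolding quasi_def nonlosing_def using wins_move_I wins_move_II
  by (smt (verit, best) mem_Collect_eq)

text \<open>A strategy winning inside the set would win in all of \<open>S\<close>: at the first
  position that leaves the set, player I already wins in \<open>S\<close> and switches to a strategy
  for that position.\<close>

lemma not_wins_nonlosing:
  assumes "p \<in> nonlosing S C"
  shows "\<not> wins p (nonlosing S C) C"
proof
  let ?N = "nonlosing S C"
  assume "wins p ?N C"
  then obtain \<sigma> where \<sigma>: "\<And>x. x \<in> paths p ?N \<Longrightarrow> conforms p \<sigma> x \<Longrightarrow> x \<in> C"
    unfolding wins_def by blast
  have "\<forall>r. \<exists>\<sigma>. r \<in> S \<and> r \<notin> ?N \<longrightarrow> (\<forall>x\<in>paths r S. conforms r \<sigma> x \<longrightarrow> x \<in> C)"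
    unfolding nonlosing_def wins_def by blast
  then obtain \<tau> where \<tau>: "\<And>r x. r \<in> S \<Longrightarrow> r \<notin> ?N \<Longrightarrow> x \<in> paths r S \<Longrightarrow> conforms r (\<tau> r) x \<Longrightarrow> x \<in> C"
    by metis
  define left where "left u k \<longleftrightarrow> length p \<le> k \<and> k \<le> length u \<and> take k u \<notin> ?N" for u k
  define \<sigma>' where "\<sigma>' u = (if Ex (left u) then \<tau> (take (LEAST k. left u k) u) u else \<sigma> u)" for u
  have "x \<in> C" if x: "x \<in> paths p S" "conforms p \<sigma>' x" for x
  proof (cases "\<exists>k\<ge>length p. pre x k \<notin> ?N")
    case False
    then have "\<sigma>' (pre x k) = \<sigma> (pre x k)" for k
      unfolding \<sigma>'_def by (intro if_not_P) (auto simp: left_def take_pre)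
    then have "conforms p \<sigma> x" using x(2) by (simp add: conforms_def)
    moreover have "x \<in> paths p ?N" using False x(1) by (auto simp: paths_def)
    ultimately show ?thesis using \<sigma> by blast
  next
    case True
    define k where "k = (LEAST k. length p \<le> k \<and> pre x k \<notin> ?N)"
    have k: "length p \<le> k" "pre x k \<notin> ?N"
      using LeastI_ex[of "\<lambda>k. length p \<le> k \<and> pre x k \<notin> ?N"] True unfolding k_def by auto
    have kl: "k \<le> j" if "length p \<le> j" "pre x j \<notin> ?N" for j
      unfolding k_def using that by (intro Least_le) simp
    have "\<sigma>' (pre x l) = \<tau> (pre x k) (pre x l)" if "l \<ge> k" for l
    proof -
      have 1: "left (pre x l) k" using k that by (simp add: left_def take_pre)
      moreover have "(LEAST k. left (pre x l) k) = k"
        using 1 by (intro Least_equality) (auto simp: left_def take_pre intro: kl)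
      ultimately show ?thesis using that by (auto simp: \<sigma>'_def take_pre)
    qed
    then have "conforms (pre x k) (\<tau> (pre x k)) x"
      using x(2) k(1) by (simp add: conforms_def)
    moreover have "pre x k \<in> S" using x(1) k(1) by (simp add: paths_def)
    ultimately show ?thesis using \<tau> k paths_pre[OF x(1)] by blast
  qed
  then have "wins p S C" unfolding wins_def by blast
  then show False using assms by (simp add: nonlosing_def)
qed

text \<open>The core of Davis's proof, for a single G-delta part of \<open>C\<close>: player II can
  give up moves so as to avoid this part without letting player I win \<open>C\<close>. If that were
  impossible at \<open>p\<close>, the failure would reproduce itself at later positions until player
  I wins \<open>C\<close> from \<open>p\<close>.\<close>

lemma avoid_infinitely_often:
  assumes S: "quasi S" "p \<in> S" "\<not> wins p S C"
    and BC: "{x. \<exists>\<^sub>\<infinity>k. P (pre x k)} \<subseteq> C"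
  shows "\<exists>S'\<subseteq>S. quasi S' \<and> p \<in> S' \<and> \<not> wins p S' C \<and> (\<forall>x\<in>paths p S'. \<not> (\<exists>\<^sub>\<infinity>k. P (pre x k)))"
proof (rule ccontr)
  define good where "good q S' \<longleftrightarrow> S' \<subseteq> S \<and> quasi S' \<and> q \<in> S' \<and> \<not> wins q S' C
      \<and> (\<forall>x\<in>paths q S'. \<not> (\<exists>\<^sub>\<infinity>k. P (pre x k)))" for q S'
  define bad where "bad q \<longleftrightarrow> (\<nexists>S'. good q S')" for q
  assume "\<not> ?thesis"
  then have badp: "bad p" unfolding bad_def good_def by blast
  \<comment> \<open>The visit lies strictly after \<open>q\<close>, so that every restart of a
    strategy happens at a longer position.\<close>
  define E where "E q = {x. \<exists>k>length q. P (pre x k) \<and> bad (pre x k)}" for q :: "'m list"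
  \<comment> \<open>Otherwise the second player could stay on nonlosing positions and, at the first later visit to \<open>P\<close>,
    switch to a witness of goodness, so that \<open>q\<close> would be good itself.\<close>
  have wins_E: "wins q S (C \<union> E q)" if q: "q \<in> S" "bad q" for q
  proof (rule ccontr)
    assume nw: "\<not> wins q S (C \<union> E q)"
    let ?N = "nonlosing S (C \<union> E q)"
    have qN: "q \<in> ?N" using q nw by (simp add: nonlosing_def)
    have "\<forall>u. \<exists>S'. \<not> bad u \<longrightarrow> good u S'" unfolding bad_def by blast
    from choice[OF this] obtain T where T0: "\<And>u. \<not> bad u \<Longrightarrow> good u (T u)" by blast
    have T: "good r (T r)" if r: "r \<in> ?N" "P r" "length r > length q" for r
    proof (rule T0, rule notI)
      assume "bad r"
      \<comment> \<open>Every path through a bad \<open>r\<close> lies in \<open>E q\<close>, so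
        player I wins there with any strategy, against \<open>r \<in> ?N\<close>.\<close>
      then have "paths r S \<subseteq> E q"
        using r(2,3) unfolding paths_def E_def by (auto intro!: exI[of _ "length r"])
      then have "wins r S (C \<union> E q)" unfolding wins_def by blast
      then show False using r(1) by (simp add: nonlosing_def)
    qed
    \<comment> \<open>At most one \<open>j\<close> qualifies: the length at which \<open>r\<close>
      first visits \<open>P\<close> strictly after \<open>q\<close>. From there on the tree of that
      visit decides membership in \<open>S'\<close>.\<close>
    define hit where "hit j r \<longleftrightarrow> length q < j \<and> j \<le> length r \<and> P (take j r)
        \<and> (\<forall>i<j. length q < i \<longrightarrow> \<not> P (take i r))" for j and r :: "'m list"
    have hit_snoc: "hit j (r @ [m]) \<longleftrightarrow> hit j r \<or> (j = Suc (length r) \<and> length q \<le> length r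
        \<and> P (r @ [m]) \<and> (\<forall>i. \<not> hit i r))" for j r m
    proof (cases "j \<le> length r")
      case True
      then show ?thesis by (auto simp: hit_def)
    next
      case False
      have "(\<exists>i. hit i r) \<longleftrightarrow> (\<exists>i\<le>length r. length q < i \<and> P (take i r))"
      proof
        assume "\<exists>i\<le>length r. length q < i \<and> P (take i r)"
        then have "\<exists>i. i \<le> length r \<and> length q < i \<and> P (take i r)" by blast
        then obtain i where "i \<le> length r \<and> length q < i \<and> P (take i r)"
          "\<forall>j<i. \<not> (j \<le> length r \<and> length q < j \<and> P (take j r))"
          using exists_least_iff[of "\<lambda>i. i \<le> length r \<and> length q < i \<and> P (take i r)"] by blast
        then have "hit i r" unfolding hit_def by auto
        then show "\<exists>i. hit i r" ..
      qed (auto simp: hit_def)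
      with False show ?thesis by (auto simp: hit_def less_Suc_eq_le le_Suc_eq)
    qed
    have hit_unique: "i = j" if "hit i r" "hit j r" for i j r
      using that unfolding hit_def by (metis linorder_neqE_nat)
    define S' where "S' = {r \<in> ?N. \<forall>j. \<not> hit j r} \<union> {r. \<exists>j. hit j r \<and> take j r \<in> ?N \<and> r \<in> T (take j r)}"
    have T_hit: "good (take j r) (T (take j r))" if "hit j r" "take j r \<in> ?N" for j r
      using that by (intro T) (auto simp: hit_def)
    have N_S': "r @ [m] \<in> S'" if "r \<in> ?N" "\<forall>j. \<not> hit j r" "r @ [m] \<in> ?N" for r m
    proof (cases "\<exists>j. hit j (r @ [m])")
      case True
      then obtain j where j: "hit j (r @ [m])" by blast
      then have "take j (r @ [m]) = r @ [m]" using that(2) by (auto simp: hit_snoc)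
      then show ?thesis using j T_hit[OF j] that(3) unfolding S'_def good_def by auto
    qed (use that in \<open>simp add: S'_def\<close>)
    have T_S': "r @ [m] \<in> S'" if "hit j r" "take j r \<in> ?N" "r @ [m] \<in> T (take j r)" for r m j
    proof -
      have "hit j (r @ [m])" "take j (r @ [m]) = take j r" using that(1) by (auto simp: hit_snoc hit_def)
      with that show ?thesis unfolding S'_def by auto
    qed
    have "quasi S'"
      unfolding quasi_def
    proof
      fix r assume "r \<in> S'"
      then consider "r \<in> ?N" "\<forall>j. \<not> hit j r" | j where "hit j r" "take j r \<in> ?N" "r \<in> T (take j r)"
        unfolding S'_def by blast
      then show "if I r then \<forall>m. r @ [m] \<in> S' else \<exists>m. r @ [m] \<in> S'"
      proof cases
        case 1
        then show ?thesis using quasi_nonlosing[OF S(1), of "C \<union> E q"] N_S'[OF 1]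
          unfolding quasi_def by metis
      next
        case 2
        then show ?thesis using T_hit[OF 2(1,2)] T_S'[OF 2(1,2)]
          unfolding good_def quasi_def by metis
      qed
    qed
    moreover have "S' \<subseteq> S"
      using T_hit unfolding S'_def good_def nonlosing_def by blast
    moreover have "q \<in> S'" using qN by (simp add: S'_def hit_def)
    moreover have "\<not> (\<exists>\<^sub>\<infinity>k. P (pre x k))" if x: "x \<in> paths q S'" for x
    proof
      assume inf: "\<exists>\<^sub>\<infinity>k. P (pre x k)"
      then have "\<exists>k. length q < k \<and> P (pre x k)" by (auto simp: INFM_nat)
      then obtain k where k: "length q < k \<and> P (pre x k)" "\<forall>j<k. \<not> (length q < j \<and> P (pre x j))"
        using exists_least_iff[of "\<lambda>k. length q < k \<and> P (pre x k)"] by blast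
      have h: "hit k (pre x l)" if "l \<ge> k" for l
        using k that by (auto simp: hit_def take_pre)
      have l: "pre x k \<in> ?N" "pre x l \<in> T (pre x k)" if kl: "l \<ge> k" for l
      proof -
        have "pre x l \<in> S'" using x k(1) kl by (simp add: paths_def)
        then obtain j where "hit j (pre x l)" "take j (pre x l) \<in> ?N" "pre x l \<in> T (take j (pre x l))"
          using h[OF kl] unfolding S'_def by blast
        then show "pre x k \<in> ?N" "pre x l \<in> T (pre x k)"
          using hit_unique[OF h[OF kl]] kl by (auto simp: take_pre)
      qed
      then have "x \<in> paths (pre x k) (T (pre x k))" by (simp add: paths_def)
      moreover have "good (pre x k) (T (pre x k))" using l[OF order_refl] k by (intro T) auto
      ultimately show False using inf unfolding good_def by blast
    qed
    \<comment> \<open>A strategy winning \<open>C\<close> in \<open>S'\<close> never lets a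
      conforming play through \<open>?N\<close> reach \<open>P\<close>: from the first visit
      \<open>?u\<close> it would go on to win \<open>C\<close> inside \<open>T ?u\<close>, which
      \<open>good\<close> excludes. So it already wins \<open>C\<close> within
      \<open>?N\<close>.\<close>
    moreover have "\<not> wins q S' C"
    proof
      assume "wins q S' C"
      then obtain \<sigma> where \<sigma>: "\<And>x. x \<in> paths q S' \<Longrightarrow> conforms q \<sigma> x \<Longrightarrow> x \<in> C"
        unfolding wins_def by blast
      have "y \<in> C" if y: "y \<in> paths q ?N" "conforms q \<sigma> y" for y
      proof (cases "\<exists>k. length q < k \<and> P (pre y k)")
        case False
        then have "y \<in> paths q S'" using y(1) by (auto simp: paths_def S'_def hit_def take_pre)
        then show ?thesis using \<sigma> y by blast
      next
        case True
        then obtain k where k: "length q < k \<and> P (pre y k)" "\<forall>j<k. \<not> (length q < j \<and> P (pre y j))"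
          using exists_least_iff[of "\<lambda>k. length q < k \<and> P (pre y k)"] by blast
        let ?u = "pre y k"
        have u: "?u \<in> ?N" using y(1) k(1) by (simp add: paths_def)
        then have g: "good ?u (T ?u)" using k by (intro T) auto
        have "z \<in> C" if z: "z \<in> paths ?u (T ?u)" "conforms ?u \<sigma> z" for z
        proof (rule \<sigma>)
          have zy: "pre z l = pre y l" if "l \<le> k" for l
            using z(1) that pre_eq_take[of z k y l] by (simp add: paths_def)
          have "z l = y l" if "l < k" for l using zy[OF order_refl] that by (simp add: list_eq_iff_nth_eq)
          then show "conforms q \<sigma> z" using y(2) z(2) zy unfolding conforms_def
            by (metis diff_zero length_map length_upt linorder_not_le nless_le)
          have "pre z l \<in> S'" if l: "l \<ge> length q" for l
          proof (cases "l < k")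
            case True
            then have "pre y l \<in> ?N" "\<forall>j. \<not> hit j (pre y l)" using y(1) l k
              by (auto simp: paths_def hit_def take_pre)
            then have "pre y l \<in> S'" by (simp add: S'_def)
            then show ?thesis using True zy[of l] by (metis less_imp_le)
          next
            case False
            have tz: "take i (pre z l) = pre y i" if "i \<le> k" for i
              using that False zy[OF that] by (metis take_pre le_trans linorder_not_le less_imp_le)
            have "length (pre z l) = l" by simp
            with False have "hit k (pre z l)"
              unfolding hit_def using k tz by (metis less_imp_le linorder_not_le order_refl)
            moreover have "take k (pre z l) = ?u" using tz by blast
            moreover have "pre z l \<in> T ?u" using z(1) False by (simp add: paths_def)
            ultimately show ?thesis using u unfolding S'_def by auto
          qed
          moreover have "pre z (length q) = q"
            using zy[of "length q"] k(1) y(1) unfolding paths_def by (simp only: less_imp_le mem_Collect_eq)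
          ultimately show "z \<in> paths q S'" by (simp only: paths_def mem_Collect_eq) blast
        qed
        then have "wins ?u (T ?u) C" unfolding wins_def by blast
        then show ?thesis using g unfolding good_def by blast
      qed
      then have "wins q ?N (C \<union> E q)" unfolding wins_def by blast
      then show False using not_wins_nonlosing[OF qN] by blast
    qed
    ultimately have "good q S'" unfolding good_def by blast
    then show False using q(2) unfolding bad_def by blast
  qed
  then obtain \<sigma> where \<sigma>: "\<And>q x. q \<in> S \<Longrightarrow> bad q \<Longrightarrow> x \<in> paths q S \<Longrightarrow> conforms q (\<sigma> q) x \<Longrightarrow> x \<in> C \<union> E q"
    unfolding wins_def by metis
  \<comment> \<open>Restart the strategy at every visit to \<open>P\<close> in a bad position: infinitely many restarts win by
    \<open>BC\<close>, and after the last one \<open>E\<close> is avoided.\<close>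
  define sw where "sw u k \<longleftrightarrow> k \<le> length u \<and> (k = length p \<or> length p < k \<and> P (take k u) \<and> bad (take k u))" for u k
  define \<sigma>' where "\<sigma>' u = \<sigma> (take (GREATEST k. sw u k) u) u" for u
  have "x \<in> C" if x: "x \<in> paths p S" "conforms p \<sigma>' x" for x
  proof (cases "\<exists>\<^sub>\<infinity>k. P (pre x k)")
    case True
    then show ?thesis using BC by blast
  next
    case False
    let ?K = "insert (length p) {k. length p < k \<and> P (pre x k) \<and> bad (pre x k)}"
    have "finite {k. P (pre x k)}" using False unfolding INFM_iff_infinite by simp
    then have fin: "finite ?K" by (auto elim: rev_finite_subset)
    define k where "k = Max ?K"
    have kK: "k \<in> ?K" unfolding k_def using fin by (intro Max_in) auto
    have kmax: "j \<le> k" if "j \<in> ?K" for j unfolding k_def using fin that by (rule Max_ge)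
    have kp: "length p \<le> k" using kK by auto
    have bad: "bad (pre x k)" using kK badp x(1) by (auto simp: paths_def)
    have "\<sigma>' (pre x l) = \<sigma> (pre x k) (pre x l)" if "l \<ge> k" for l
    proof -
      have "(GREATEST k. sw (pre x l) k) = k"
        using kK kmax that by (intro Greatest_equality) (auto simp: sw_def take_pre)
      then show ?thesis using that by (simp add: \<sigma>'_def take_pre)
    qed
    then have "conforms (pre x k) (\<sigma> (pre x k)) x" using x(2) kp by (simp add: conforms_def)
    moreover have "pre x k \<in> S" using x(1) kp by (simp add: paths_def)
    ultimately have "x \<in> C \<union> E (pre x k)" using \<sigma> bad paths_pre[OF x(1) kp] by blast
    moreover have "x \<notin> E (pre x k)"
    proof
      assume "x \<in> E (pre x k)"
      then obtain l where "k < l" "P (pre x l)" "bad (pre x l)" unfolding E_def by auto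
      then show False using kmax[of l] kp by simp
    qed
    ultimately show ?thesis by blast
  qed
  then have "wins p S C" unfolding wins_def by blast
  then show False using S(3) by blast
qed

text \<open>If player I does not win at the start, player II shrinks the tree at every position, at
  length \<open>n\<close> so as to avoid infinitely many visits to \<open>P n\<close>. The trees
  decrease along a play, so the play stays in each of them from the moment it was chosen and escapes
  every \<open>P n\<close>.\<close>

theorem Sigma3_determinacy:
  assumes C: "C = {x. \<exists>n::nat. \<exists>\<^sub>\<infinity>k. P n (pre x k)}"
  shows "(\<exists>\<sigma>. \<forall>x. (\<forall>k. I (pre x k) \<longrightarrow> x k = \<sigma> (pre x k)) \<longrightarrow> x \<in> C) \<or>
    (\<exists>\<sigma>. \<forall>x. (\<forall>k. \<not> I (pre x k) \<longrightarrow> x k = \<sigma> (pre x k)) \<longrightarrow> x \<notin> C)"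
proof (cases "wins [] UNIV C")
  case True
  then show ?thesis by (simp add: wins_def paths_def conforms_def)
next
  case False
  define refine where "refine n u S = (SOME S'. S' \<subseteq> S \<and> quasi S' \<and> u \<in> S' \<and> \<not> wins u S' C
      \<and> (\<forall>x\<in>paths u S'. \<not> (\<exists>\<^sub>\<infinity>k. P n (pre x k))))" for n u S
  have refine: "refine n u S \<subseteq> S \<and> quasi (refine n u S) \<and> u \<in> refine n u S \<and> \<not> wins u (refine n u S) C
      \<and> (\<forall>x\<in>paths u (refine n u S). \<not> (\<exists>\<^sub>\<infinity>k. P n (pre x k)))"
    if "quasi S" "u \<in> S" "\<not> wins u S C" for n u S
    unfolding refine_def
    by (rule someI_ex, rule avoid_infinitely_often) (use that C in auto)
  \<comment> \<open>Recursion on the reversed position, with the latest move at the head.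
    \<open>Suc (length v)\<close> is the length of \<open>rev (m # v)\<close>, so index
    \<open>n\<close> is treated at length \<open>n\<close>, the empty position taking index
    0.\<close>
  define R where "R = rec_list (refine 0 [] UNIV) (\<lambda>m v S. refine (Suc (length v)) (rev (m # v)) S)"
  have R: "R [] = refine 0 [] UNIV" "R (m # v) = refine (Suc (length v)) (rev (m # v)) (R v)" for m v
    by (simp_all add: R_def)
  define \<sigma> where "\<sigma> u = (SOME m. u @ [m] \<in> R (rev u) \<and> \<not> wins (u @ [m]) (R (rev u)) C)" for u
  have "x \<notin> C" if x: "\<forall>k. \<not> I (pre x k) \<longrightarrow> x k = \<sigma> (pre x k)" for x
  proof
    assume "x \<in> C"
    then obtain n where n: "\<exists>\<^sub>\<infinity>k. P n (pre x k)" unfolding C by blast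
    let ?R = "\<lambda>k. R (rev (pre x k))"
    have inv: "quasi (?R k) \<and> pre x k \<in> ?R k \<and> \<not> wins (pre x k) (?R k) C
        \<and> (\<forall>y\<in>paths (pre x k) (?R k). \<not> (\<exists>\<^sub>\<infinity>i. P k (pre y i))) \<and> ?R (Suc k) \<subseteq> ?R k" for k
    proof -
      have next': "pre x (Suc k) \<in> ?R k \<and> \<not> wins (pre x (Suc k)) (?R k) C"
        if "quasi (?R k)" "pre x k \<in> ?R k" "\<not> wins (pre x k) (?R k) C" for k
      proof (cases "I (pre x k)")
        case True
        then show ?thesis using that wins_move_I[OF True] unfolding quasi_def by simp blast
      next
        case False
        then have "\<exists>m. pre x k @ [m] \<in> ?R k \<and> \<not> wins (pre x k @ [m]) (?R k) C"
          using that(3) wins_move_II by blast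
        from someI_ex[OF this] x False show ?thesis by (simp add: \<sigma>_def)
      qed
      have "quasi (?R k) \<and> pre x k \<in> ?R k \<and> \<not> wins (pre x k) (?R k) C
        \<and> (\<forall>y\<in>paths (pre x k) (?R k). \<not> (\<exists>\<^sub>\<infinity>i. P k (pre y i)))" (is "?Q k")
      proof (induction k)
        case 0
        then show ?case using refine[of UNIV "[]" 0] False by (simp add: R quasi_def)
      next
        case (Suc k)
        then show ?case using refine[of "?R k" "pre x (Suc k)" "Suc k"] next'[of k] by (simp add: R)
      qed
      then show ?thesis using refine[of "?R k" "pre x (Suc k)" "Suc k"] next'[of k] by (simp add: R)
    qed
    have "?R k \<subseteq> ?R n" if "n \<le> k" for k
      using that by (induction k rule: dec_induct) (use inv in blast)+
    then have "x \<in> paths (pre x n) (?R n)" using inv by (auto simp: paths_def)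
    then show False using inv n by blast
  qed
  then show ?thesis by blast
qed

end

section \<open>Topological complexity of LTL properties\<close>

text \<open>Quantifiers and bindings are atoms here: in OGSL they head sentences, whose truth depends on the
  state only.\<close>

primrec lsat :: "('ap::finite, 'ag::finite, 'ac::countable, 'st::countable) cgs \<Rightarrow> ('ap, 'ag, 'v) sl
    \<Rightarrow> (nat \<Rightarrow> 'st) \<Rightarrow> nat \<Rightarrow> bool" where
  "lsat G (Atom p) \<pi> i \<longleftrightarrow> p \<in> label G (\<pi> i)"
| "lsat G (Neg \<phi>) \<pi> i \<longleftrightarrow> \<not> lsat G \<phi> \<pi> i"
| "lsat G (Conj \<phi> \<psi>) \<pi> i \<longleftrightarrow> lsat G \<phi> \<pi> i \<and> lsat G \<psi> \<pi> i"
| "lsat G (Disj \<phi> \<psi>) \<pi> i \<longleftrightarrow> lsat G \<phi> \<pi> i \<or> lsat G \<psi> \<pi> i"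
| "lsat G (Next \<phi>) \<pi> i \<longleftrightarrow> lsat G \<phi> \<pi> (Suc i)"
| "lsat G (Until \<phi> \<psi>) \<pi> i \<longleftrightarrow> (\<exists>k. lsat G \<psi> \<pi> (i + k) \<and> (\<forall>j<k. lsat G \<phi> \<pi> (i + j)))"
| "lsat G (Release \<phi> \<psi>) \<pi> i \<longleftrightarrow> (\<forall>k. lsat G \<psi> \<pi> (i + k) \<or> (\<exists>j<k. lsat G \<phi> \<pi> (i + j)))"
| "lsat G (ExStr x \<phi>) \<pi> i \<longleftrightarrow> sat G (ExStr x \<phi>) Map.empty (\<pi> i)"
| "lsat G (AllStr x \<phi>) \<pi> i \<longleftrightarrow> sat G (AllStr x \<phi>) Map.empty (\<pi> i)"
| "lsat G (Bind a x \<phi>) \<pi> i \<longleftrightarrow> sat G (Bind a x \<phi>) Map.empty (\<pi> i)"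

section \<open>Backward evaluation of LTL formulas\<close>

primrec subformulas :: "('ap, 'ag, 'v) sl \<Rightarrow> ('ap, 'ag, 'v) sl set" where
  "subformulas (Atom p) = {Atom p}"
| "subformulas (Neg \<phi>) = insert (Neg \<phi>) (subformulas \<phi>)"
| "subformulas (Conj \<phi> \<psi>) = insert (Conj \<phi> \<psi>) (subformulas \<phi> \<union> subformulas \<psi>)"
| "subformulas (Disj \<phi> \<psi>) = insert (Disj \<phi> \<psi>) (subformulas \<phi> \<union> subformulas \<psi>)"
| "subformulas (Next \<phi>) = insert (Next \<phi>) (subformulas \<phi>)"
| "subformulas (Until \<phi> \<psi>) = insert (Until \<phi> \<psi>) (subformulas \<phi> \<union> subformulas \<psi>)"
| "subformulas (Release \<phi> \<psi>) = insert (Release \<phi> \<psi>) (subformulas \<phi> \<union> subformulas \<psi>)"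
| "subformulas (ExStr x \<phi>) = {ExStr x \<phi>}"
| "subformulas (AllStr x \<phi>) = {AllStr x \<phi>}"
| "subformulas (Bind a x \<phi>) = {Bind a x \<phi>}"

lemma finite_subformulas: "finite (subformulas \<phi>)"
  by (induction \<phi>) auto

lemma subformulas_refl: "\<phi> \<in> subformulas \<phi>"
  by (cases \<phi>) auto

lemma subformulas_trans: "\<psi> \<in> subformulas \<phi> \<Longrightarrow> subformulas \<psi> \<subseteq> subformulas \<phi>"
  by (induction \<phi>) auto

text \<open>\<open>V\<close> stands for the formulas true at the next position. Until and Release
  follow their expansion laws, which lets truth propagate backwards one state at a time.\<close>

primrec now :: "('ap::finite, 'ag::finite, 'ac::countable, 'st::countable) cgs \<Rightarrow> 'st
    \<Rightarrow> ('ap, 'ag, 'v) sl set \<Rightarrow> ('ap, 'ag, 'v) sl \<Rightarrow> bool" where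
  "now G s V (Atom p) \<longleftrightarrow> p \<in> label G s"
| "now G s V (Neg \<phi>) \<longleftrightarrow> \<not> now G s V \<phi>"
| "now G s V (Conj \<phi> \<psi>) \<longleftrightarrow> now G s V \<phi> \<and> now G s V \<psi>"
| "now G s V (Disj \<phi> \<psi>) \<longleftrightarrow> now G s V \<phi> \<or> now G s V \<psi>"
| "now G s V (Next \<phi>) \<longleftrightarrow> \<phi> \<in> V"
| "now G s V (Until \<phi> \<psi>) \<longleftrightarrow> now G s V \<psi> \<or> now G s V \<phi> \<and> Until \<phi> \<psi> \<in> V"
| "now G s V (Release \<phi> \<psi>) \<longleftrightarrow> now G s V \<psi> \<and> (now G s V \<phi> \<or> Release \<phi> \<psi> \<in> V)"
| "now G s V (ExStr x \<phi>) \<longleftrightarrow> sat G (ExStr x \<phi>) Map.empty s"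
| "now G s V (AllStr x \<phi>) \<longleftrightarrow> sat G (AllStr x \<phi>) Map.empty s"
| "now G s V (Bind a x \<phi>) \<longleftrightarrow> sat G (Bind a x \<phi>) Map.empty s"

lemma until_unfold:
  "(\<exists>k. b (l + k) \<and> (\<forall>j<k. a (l + j))) \<longleftrightarrow>
    b l \<or> (a l \<and> (\<exists>k. b (Suc l + k) \<and> (\<forall>j<k. a (Suc l + j))))" (is "?L \<longleftrightarrow> ?R")
proof
  assume ?L
  then obtain k where k: "b (l + k)" "\<forall>j<k. a (l + j)" by blast
  show ?R
  proof (cases k)
    case (Suc k')
    then show ?thesis using k by (auto intro!: exI[of _ k'])
  qed (use k in simp)
next
  assume ?R
  then show ?L
  proof
    assume "a l \<and> (\<exists>k. b (Suc l + k) \<and> (\<forall>j<k. a (Suc l + j)))"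
    then obtain k where "a l" "b (Suc l + k)" "\<forall>j<k. a (Suc l + j)" by blast
    then have "b (l + Suc k) \<and> (\<forall>j<Suc k. a (l + j))" by (auto simp: less_Suc_eq_0_disj)
    then show ?L by blast
  qed (auto intro: exI[of _ 0])
qed

text \<open>The expansion law alone also admits the solution that promises \<open>b\<close> forever
  without delivering it; \<open>fair\<close> excludes that one and leaves the least fixed
  point.\<close>

lemma until_unique:
  fixes u a b :: "nat \<Rightarrow> bool"
  assumes step: "\<And>l. i \<le> l \<Longrightarrow> u l \<longleftrightarrow> b l \<or> (a l \<and> u (Suc l))"
    and l: "i \<le> l"
    and fair: "\<And>l. i \<le> l \<Longrightarrow> (\<And>m. l \<le> m \<Longrightarrow> u m) \<Longrightarrow> \<exists>m\<ge>l. b m"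
  shows "u l \<longleftrightarrow> (\<exists>k. b (l + k) \<and> (\<forall>j<k. a (l + j)))"
proof
  assume u: "u l"
  have until: "u (l + k) \<and> (\<forall>j<k. a (l + j))" if "\<forall>j<k. \<not> b (l + j)" for k
    using that
  proof (induction k)
    case (Suc k)
    then show ?case using step[of "l + k"] l by (auto simp: less_Suc_eq)
  qed (use u in simp)
  have "\<exists>k. b (l + k)"
  proof (rule ccontr)
    assume nb: "\<nexists>k. b (l + k)"
    then have "u m" if "l \<le> m" for m using until[of "m - l"] that by simp
    then obtain m where "m \<ge> l" "b m" using fair[OF l] by blast
    with nb show False by (metis le_add_diff_inverse)
  qed
  then obtain k where "b (l + k)" "\<forall>j<k. \<not> b (l + j)"
    using exists_least_iff[of "\<lambda>k. b (l + k)"] by blast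
  then show "\<exists>k. b (l + k) \<and> (\<forall>j<k. a (l + j))" using until by blast
next
  assume "\<exists>k. b (l + k) \<and> (\<forall>j<k. a (l + j))"
  then obtain k where "b (l + k)" "\<forall>j<k. a (l + j)" by blast
  then show "u l" using l
  proof (induction k arbitrary: l)
    case (Suc k)
    have "u (Suc l)" using Suc.prems by (intro Suc.IH) auto
    then show ?case using step[of l] Suc.prems by auto
  next
    case 0
    then show ?case using step[of l] by simp
  qed
qed

definition regress where "regress G S s V = {\<psi> \<in> S. now G s V \<psi>}"

text \<open>The set \<open>V\<close> at the right end is left out, so that adjacent segments
  contribute half-open ranges of positions.\<close>

primrec seen where
  "seen G S [] V = {}"
| "seen G S (s # w) V = insert (foldr (regress G S) (s # w) V) (seen G S w V)"

lemma seen_append: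
  "seen G S (v @ w) V = seen G S v (foldr (regress G S) w V) \<union> seen G S w V"
  by (induction v) auto

lemma foldr_regress_subset: "V \<subseteq> S \<Longrightarrow> foldr (regress G S) w V \<subseteq> S"
  by (cases w) (auto simp: regress_def)

lemma seen_subset: "V \<subseteq> S \<Longrightarrow> seen G S w V \<subseteq> Pow S"
proof (induction w)
  case (Cons s w)
  then show ?case using foldr_regress_subset[of V S G "s # w"] by auto
qed simp

text \<open>Inspecting the obligations at the cut alone suffices: an Until that holds forever holds
  at every cut, and dually for a Release that fails forever.\<close>

definition fair where
  "fair S V X \<longleftrightarrow> (\<forall>\<phi> \<psi>. Until \<phi> \<psi> \<in> V \<longrightarrow> (\<exists>W\<in>X. \<psi> \<in> W)) \<and>
    (\<forall>\<phi> \<psi>. Release \<phi> \<psi> \<in> S - V \<longrightarrow> (\<exists>W\<in>X. \<psi> \<notin> W))"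

text \<open>Recording the visited sets besides the map keeps fairness unchanged when a word is
  replaced by one with the same summary. The restriction to \<open>Pow S\<close> keeps the number of
  summaries finite.\<close>

definition summary where
  "summary G S w = (\<lambda>V\<in>Pow S. (foldr (regress G S) w V, seen G S w V))"

lemma summary_eq:
  assumes "summary G S v = summary G S w" "V \<subseteq> S"
  shows "foldr (regress G S) (v @ u) V = foldr (regress G S) (w @ u) V"
    and "seen G S (v @ u) V = seen G S (w @ u) V"
proof -
  have "summary G S v (foldr (regress G S) u V) = summary G S w (foldr (regress G S) u V)"
    using assms(1) by simp
  then show "foldr (regress G S) (v @ u) V = foldr (regress G S) (w @ u) V"
    "seen G S (v @ u) V = seen G S (w @ u) V"
    using foldr_regress_subset[OF assms(2), of G u] by (simp_all add: summary_def seen_append)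
qed

lemma finite_summaries: "finite S \<Longrightarrow> finite (range (summary G S))"
proof (rule finite_subset)
  assume "finite S"
  then show "finite (Pow S \<rightarrow>\<^sub>E (Pow S \<times> Pow (Pow S)))" by (intro finite_PiE) auto
  show "range (summary G S) \<subseteq> (Pow S \<rightarrow>\<^sub>E (Pow S \<times> Pow (Pow S)))"
  proof (rule image_subsetI)
    fix w
    show "summary G S w \<in> (Pow S \<rightarrow>\<^sub>E (Pow S \<times> Pow (Pow S)))"
      unfolding summary_def restrict_PiE_iff using foldr_regress_subset[of _ S G w] seen_subset[of _ S G w] by simp
  qed
qed

section \<open>Fair runs along an infinite path\<close>

abbreviation segment :: "(nat \<Rightarrow> 'm) \<Rightarrow> nat \<Rightarrow> nat \<Rightarrow> 'm list" where
  "segment \<pi> i j \<equiv> map \<pi> [i..<j]"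

lemma segment_append: "i \<le> j \<Longrightarrow> j \<le> k \<Longrightarrow> segment \<pi> i k = segment \<pi> i j @ segment \<pi> j k"
  using upt_add_eq_append[of i j "k - j"] by simp

lemma run_segment:
  assumes "\<And>l. i \<le> l \<Longrightarrow> W l = regress G S (\<pi> l) (W (Suc l))" "i \<le> j" "j \<le> k"
  shows "foldr (regress G S) (segment \<pi> j k) (W k) = W j"
    and "seen G S (segment \<pi> j k) (W k) = W ` {j..<k}"
  using assms(3,2)
proof (induction j rule: inc_induct)
  case (step j)
  have e: "[j..<k] = j # [Suc j..<k]" "{j..<k} = insert j {Suc j..<k}"
    using step(2) by (auto simp: upt_conv_Cons)
  {
    case 1
    then show ?case using step assms(1)[of j] by (simp add: e)
  next
    case 2
    then show ?case using step assms(1)[of j] by (simp add: e)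
  }
qed simp_all

text \<open>Induction on the formula: the local equations settle everything but Until and Release,
  and for these fairness allows \<open>until_unique\<close>, applied to Release through its
  negation.\<close>

lemma fair_run_truth:
  assumes S: "\<And>\<psi>. \<psi> \<in> S \<Longrightarrow> subformulas \<psi> \<subseteq> S"
    and W: "\<And>l. i \<le> l \<Longrightarrow> W l = regress G S (\<pi> l) (W (Suc l))"
    and fU: "\<And>l \<phi> \<psi>. i \<le> l \<Longrightarrow> (\<And>m. l \<le> m \<Longrightarrow> Until \<phi> \<psi> \<in> W m) \<Longrightarrow> \<exists>m\<ge>l. \<psi> \<in> W m"
    and fR: "\<And>l \<phi> \<psi>. i \<le> l \<Longrightarrow> Release \<phi> \<psi> \<in> S \<Longrightarrow> (\<And>m. l \<le> m \<Longrightarrow> Release \<phi> \<psi> \<notin> W m)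
      \<Longrightarrow> \<exists>m\<ge>l. \<psi> \<notin> W m"
  shows "\<psi> \<in> S \<Longrightarrow> i \<le> l \<Longrightarrow> \<psi> \<in> W l \<longleftrightarrow> lsat G \<psi> \<pi> l"
proof (induction \<psi> arbitrary: l)
  case (Conj \<psi>1 \<psi>2)
  have mem: "\<psi>1 \<in> S" "\<psi>2 \<in> S" using S[OF Conj.prems(1)] subformulas_refl by auto
  then show ?case
    using Conj.IH(1)[OF mem(1) Conj.prems(2)] Conj.IH(2)[OF mem(2) Conj.prems(2)] W[OF Conj.prems(2)]
      Conj.prems(1) by (simp add: regress_def)
next
  case (Disj \<psi>1 \<psi>2)
  have mem: "\<psi>1 \<in> S" "\<psi>2 \<in> S" using S[OF Disj.prems(1)] subformulas_refl by auto
  then show ?case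
    using Disj.IH(1)[OF mem(1) Disj.prems(2)] Disj.IH(2)[OF mem(2) Disj.prems(2)] W[OF Disj.prems(2)]
      Disj.prems(1) by (simp add: regress_def)
next
  case (Neg \<psi>)
  have mem: "\<psi> \<in> S" using S[OF Neg.prems(1)] subformulas_refl by auto
  then show ?case
    using Neg.IH[OF mem Neg.prems(2)] W[OF Neg.prems(2)] Neg.prems(1) by (simp add: regress_def)
next
  case (Next \<psi>)
  have mem: "\<psi> \<in> S" using S[OF Next.prems(1)] subformulas_refl by auto
  then show ?case
    using Next.IH[OF mem, of "Suc l"] W[OF Next.prems(2)] Next.prems by (simp add: regress_def)
next
  case (Until \<psi>1 \<psi>2)
  have mem: "\<psi>1 \<in> S" "\<psi>2 \<in> S" using S[OF Until.prems(1)] subformulas_refl by auto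
  have "Until \<psi>1 \<psi>2 \<in> W l \<longleftrightarrow> \<psi>2 \<in> W l \<or> (\<psi>1 \<in> W l \<and> Until \<psi>1 \<psi>2 \<in> W (Suc l))" if "i \<le> l" for l
    using W[OF that] mem Until.prems(1) by (auto simp: regress_def)
  then have "Until \<psi>1 \<psi>2 \<in> W l \<longleftrightarrow> (\<exists>k. \<psi>2 \<in> W (l + k) \<and> (\<forall>j<k. \<psi>1 \<in> W (l + j)))"
  proof (rule until_unique[where i = i and u = "\<lambda>l. Until \<psi>1 \<psi>2 \<in> W l" and b = "\<lambda>l. \<psi>2 \<in> W l"
      and a = "\<lambda>l. \<psi>1 \<in> W l"])
    fix l assume "i \<le> l" "\<And>m. l \<le> m \<Longrightarrow> Until \<psi>1 \<psi>2 \<in> W m"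
    then show "\<exists>m\<ge>l. \<psi>2 \<in> W m" by (rule fU)
  qed (use Until.prems(2) in auto)
  then show ?case using Until mem by simp
next
  case (Release \<psi>1 \<psi>2)
  have mem: "\<psi>1 \<in> S" "\<psi>2 \<in> S" using S[OF Release.prems(1)] subformulas_refl by auto
  have "Release \<psi>1 \<psi>2 \<notin> W l \<longleftrightarrow> \<psi>2 \<notin> W l \<or> (\<psi>1 \<notin> W l \<and> Release \<psi>1 \<psi>2 \<notin> W (Suc l))" if "i \<le> l" for l
    using W[OF that] mem Release.prems(1) by (auto simp: regress_def)
  then have "Release \<psi>1 \<psi>2 \<notin> W l \<longleftrightarrow> (\<exists>k. \<psi>2 \<notin> W (l + k) \<and> (\<forall>j<k. \<psi>1 \<notin> W (l + j)))"
  proof (rule until_unique[where i = i and u = "\<lambda>l. Release \<psi>1 \<psi>2 \<notin> W l" and b = "\<lambda>l. \<psi>2 \<notin> W l"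
      and a = "\<lambda>l. \<psi>1 \<notin> W l"])
    fix l assume "i \<le> l" "\<And>m. l \<le> m \<Longrightarrow> Release \<psi>1 \<psi>2 \<notin> W m"
    with Release.prems(1) show "\<exists>m\<ge>l. \<psi>2 \<notin> W m" by (intro fR)
  qed (use Release.prems(2) in auto)
  then show ?case using Release mem by auto
qed ((subst W; simp add: regress_def)+)

text \<open>Supplies the other direction: the sets of true formulas form a run of the backward
  evaluation.\<close>

lemma now_lsat:
  assumes S: "\<And>\<psi>. \<psi> \<in> S \<Longrightarrow> subformulas \<psi> \<subseteq> S"
  shows "\<psi> \<in> S \<Longrightarrow> now G (\<pi> l) {\<psi> \<in> S. lsat G \<psi> \<pi> (Suc l)} \<psi> \<longleftrightarrow> lsat G \<psi> \<pi> l"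
proof (induction \<psi>)
  case (Until \<psi>1 \<psi>2)
  then have mem: "\<psi>1 \<in> S" "\<psi>2 \<in> S" using S[OF Until.prems(1)] subformulas_refl by auto
  then show ?case
    using Until until_unfold[of "lsat G \<psi>2 \<pi>" l "lsat G \<psi>1 \<pi>"] by simp
next
  case (Release \<psi>1 \<psi>2)
  then have mem: "\<psi>1 \<in> S" "\<psi>2 \<in> S" using S[OF Release.prems(1)] subformulas_refl by auto
  then show ?case
    using Release until_unfold[of "\<lambda>i. \<not> lsat G \<psi>2 \<pi> i" l "\<lambda>i. \<not> lsat G \<psi>1 \<pi> i"] by simp blast
next
  case (Conj \<psi>1 \<psi>2)
  then have "\<psi>1 \<in> S" "\<psi>2 \<in> S" using S[OF Conj.prems(1)] subformulas_refl by auto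
  then show ?case using Conj by simp
next
  case (Disj \<psi>1 \<psi>2)
  then have "\<psi>1 \<in> S" "\<psi>2 \<in> S" using S[OF Disj.prems(1)] subformulas_refl by auto
  then show ?case using Disj by simp
next
  case (Neg \<psi>)
  then have "\<psi> \<in> S" using S[OF Neg.prems(1)] subformulas_refl by auto
  then show ?case using Neg by simp
next
  case (Next \<psi>)
  then have "\<psi> \<in> S" using S[OF Next.prems(1)] subformulas_refl by auto
  then show ?case using Next by simp
qed simp_all

text \<open>Backward truth-vector functions of segments form a finite monoid. A cycle \<open>i \<dots> j\<close> on \<open>V\<close> only
  extends to a run if later cycles compose with it; the last conjunct ensures this, since the
  segments from \<open>i\<close> and \<open>j\<close> act in the same way from position \<open>k\<close> on.\<close>

definition fair_cycle where
  "fair_cycle G S V \<pi> i j k \<longleftrightarrow> i < j \<and> j \<le> k \<and> foldr (regress G S) (segment \<pi> i j) V = V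
    \<and> fair S V (seen G S (segment \<pi> i j) V) \<and> summary G S (segment \<pi> i k) = summary G S (segment \<pi> j k)"

lemma fair_cycles_truth:
  assumes S: "\<And>\<psi>. \<psi> \<in> S \<Longrightarrow> subformulas \<psi> \<subseteq> S" and V: "V \<subseteq> S"
    and inf: "\<exists>\<^sub>\<infinity>j. \<exists>k. fair_cycle G S V \<pi> i j k"
    and \<phi>: "\<phi> \<in> S"
  shows "\<phi> \<in> foldr (regress G S) (segment \<pi> 0 i) V \<longleftrightarrow> lsat G \<phi> \<pi> 0"
proof -
  let ?f = "foldr (regress G S)"
  define J where "J j \<longleftrightarrow> j = i \<or> (\<exists>k. fair_cycle G S V \<pi> i j k)" for j
  define R where "R j j' \<longleftrightarrow> j < j' \<and> ?f (segment \<pi> j j') V = V \<and> fair S V (seen G S (segment \<pi> j j') V)" for j j'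
  have next': "\<exists>j'. J j' \<and> R j j'" if "J j" for j
  proof -
    obtain k where k: "j \<le> k" "i \<le> j" "summary G S (segment \<pi> i k) = summary G S (segment \<pi> j k)"
      using \<open>J j\<close> unfolding J_def fair_cycle_def by (metis less_imp_le order_refl)
    \<comment> \<open>Going past the merge position \<open>k\<close> makes the segments from
      \<open>i\<close> and from \<open>j\<close> to \<open>j'\<close> act alike, so the cycle found
      from \<open>i\<close> is also a cycle from \<open>j\<close>.\<close>
    obtain j' where j': "j' > k" "\<exists>k. fair_cycle G S V \<pi> i j' k" using inf[unfolded INFM_nat, rule_format, of k] by blast
    have "segment \<pi> i j' = segment \<pi> i k @ segment \<pi> k j'" "segment \<pi> j j' = segment \<pi> j k @ segment \<pi> k j'"
      using k j' by (auto intro!: segment_append)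
    then have "?f (segment \<pi> j j') V = ?f (segment \<pi> i j') V" "seen G S (segment \<pi> j j') V = seen G S (segment \<pi> i j') V"
      using summary_eq[OF k(3) V] by simp_all
    then show ?thesis using j' k(1) unfolding J_def R_def fair_cycle_def by auto
  qed
  have "J i" by (simp add: J_def)
  then have "\<exists>g. \<forall>n. (J (g n) \<and> (n = 0 \<longrightarrow> g n = i)) \<and> R (g n) (g (Suc n))"
    using next' by (intro dependent_nat_choice) auto
  then obtain g where g: "g 0 = i" "\<And>n. R (g n) (g (Suc n))" by metis
  have g_mono: "strict_mono g" using g(2) by (simp add: strict_mono_Suc_iff R_def)
  have g_ge: "l \<le> g l" for l using g_mono by (rule strict_mono_imp_increasing)
  have g_cyc: "?f (segment \<pi> (g m) (g n)) V = V" if "m \<le> n" for m n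
    using that
  proof (induction n rule: dec_induct)
    case (step n)
    have "segment \<pi> (g m) (g (Suc n)) = segment \<pi> (g m) (g n) @ segment \<pi> (g n) (g (Suc n))"
      using g_mono step(1) by (intro segment_append) (auto simp: strict_mono_less_eq)
    then show ?case using step g(2)[of n] by (simp add: R_def)
  qed simp
  \<comment> \<open>\<open>V\<close> is pulled back from a cut at or beyond \<open>l\<close>. The
    cut \<open>g l\<close> is late enough, and as the evaluation between cuts returns
    \<open>V\<close>, any later cut gives the same set.\<close>
  define W where "W l = ?f (segment \<pi> l (g l)) V" for l
  have W: "?f (segment \<pi> l (g n)) V = W l" if "l \<le> g n" for l n
  proof -
    have *: "?f (segment \<pi> l (g n)) V = ?f (segment \<pi> l (g m)) V" if "n \<le> m" "l \<le> g n" for n m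
      using segment_append[OF that(2), of "g m" \<pi>] g_cyc[OF that(1)] g_mono that
      by (simp add: strict_mono_less_eq)
    show ?thesis
      using *[of n l, OF _ that] *[of l n, OF _ g_ge] unfolding W_def by (metis linear)
  qed
  have Wg: "W (g n) = V" for n using W[of "g n" n] by simp
  have regress: "W l = regress G S (\<pi> l) (W (Suc l))" for l
  proof -
    have "Suc l \<le> g (Suc l)" by (rule g_ge)
    then have "[l..<g (Suc l)] = l # [Suc l..<g (Suc l)]" by (simp add: upt_conv_Cons)
    then show ?thesis using W[of l "Suc l"] W[of "Suc l" "Suc l"] g_ge[of "Suc l"] by simp
  qed
  have fair: "fair S V (W ` {g n..<g (Suc n)})" for n
  proof -
    have "seen G S (segment \<pi> (g n) (g (Suc n))) V = W ` {g n..<g (Suc n)}"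
      using run_segment(2)[of 0 W G S \<pi> "g n" "g (Suc n)", OF regress] g(2)[of n] by (simp add: Wg R_def)
    then show ?thesis using g(2)[of n] by (simp add: R_def)
  qed
  have "\<phi> \<in> W 0 \<longleftrightarrow> lsat G \<phi> \<pi> 0"
  proof (rule fair_run_truth[where i = 0])
    fix l \<phi> \<psi> assume "\<And>m. l \<le> m \<Longrightarrow> Until \<phi> \<psi> \<in> W m"
    from this[OF g_ge[of l]] have "Until \<phi> \<psi> \<in> V" by (simp add: Wg)
    with fair[of l] have "\<exists>X\<in>W ` {g l..<g (Suc l)}. \<psi> \<in> X" unfolding fair_def by blast
    then obtain m where "g l \<le> m" "\<psi> \<in> W m" by auto
    then show "\<exists>m\<ge>l. \<psi> \<in> W m" using g_ge[of l] le_trans by blast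
  next
    fix l \<phi> \<psi> assume "\<And>m. l \<le> m \<Longrightarrow> Release \<phi> \<psi> \<notin> W m" and "Release \<phi> \<psi> \<in> S"
    from this(1)[OF g_ge[of l]] this(2) have "Release \<phi> \<psi> \<in> S - V" by (simp add: Wg)
    with fair[of l] have "\<exists>X\<in>W ` {g l..<g (Suc l)}. \<psi> \<notin> X" unfolding fair_def by blast
    then obtain m where "g l \<le> m" "\<psi> \<notin> W m" by auto
    then show "\<exists>m\<ge>l. \<psi> \<notin> W m" using g_ge[of l] le_trans by blast
  qed (fact S, rule regress, rule \<phi>, simp)
  then show ?thesis using W[of 0 0] g(1) by simp
qed

text \<open>Ramsey's theorem is applied to the positions that share one truth vector, a pair being
  coloured by the summary of the segment between its members. On a homogeneous set, segments with
  the same end have equal summaries, which is the merging that \<open>fair_cycle\<close>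
  demands.\<close>

lemma fair_cycles_exist:
  assumes S: "\<And>\<psi>. \<psi> \<in> S \<Longrightarrow> subformulas \<psi> \<subseteq> S" and fin: "finite S"
  shows "\<exists>i. \<exists>V\<subseteq>S. \<exists>\<^sub>\<infinity>j. \<exists>k. fair_cycle G S V \<pi> i j k"
proof -
  define W where "W l = {\<psi> \<in> S. lsat G \<psi> \<pi> l}" for l
  have regress: "W l = regress G S (\<pi> l) (W (Suc l))" for l
    unfolding W_def regress_def using now_lsat[OF S, of _ G \<pi> l] by auto
  have "finite (range W)" by (rule finite_subset[of _ "Pow S"]) (use fin in \<open>auto simp: W_def\<close>)
  then obtain l0 where H: "infinite {l. W l = W l0}"
    using pigeonhole_infinite[of "UNIV :: nat set" W] by auto
  obtain h :: "_ \<Rightarrow> nat" and N where h: "bij_betw h (range (summary G S)) {0..<N}"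
    using ex_bij_betw_finite_nat[OF finite_summaries[OF fin]] by blast
  define c where "c i j = h (summary G S (segment \<pi> i j))" for i j
  have "c i j < N" for i j using h unfolding c_def bij_betw_def by auto
  then obtain Y t where Y: "Y \<subseteq> {l. W l = W l0}" "infinite Y"
    "\<forall>x\<in>Y. \<forall>y\<in>Y. x \<noteq> y \<longrightarrow> c (Min {x, y}) (Max {x, y}) = t"
    using Ramsey2[OF H, of "\<lambda>X. c (Min X) (Max X)" N] by auto
  have merge: "summary G S (segment \<pi> i k) = summary G S (segment \<pi> j k)"
    if "i \<in> Y" "j \<in> Y" "k \<in> Y" "i < k" "j < k" for i j k
  proof -
    have "c i k = t" if "i \<in> Y" "k \<in> Y" "i < k" for i k
      using Y(3)[rule_format, OF that(1,2)] that(3) by simp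
    then have "c i k = c j k" using that by metis
    then show ?thesis using bij_betw_imp_inj_on[OF h] unfolding c_def by (auto dest: inj_onD)
  qed
  obtain i where i: "i \<in> Y" using Y(2) infinite_imp_nonempty by blast
  have Wi: "W j = W i" if "j \<in> Y" for j using Y(1) i that by auto
  \<comment> \<open>Each obligation at the cut \<open>i\<close> is met after finitely many steps. As
    \<open>S\<close> is finite, one bound serves all of them, and a cut \<open>j\<close> beyond it
    closes a fair segment.\<close>
  have "\<forall>\<chi>\<in>S. \<forall>\<^sub>F j in at_top. (\<forall>\<phi> \<psi>. \<chi> = Until \<phi> \<psi> \<and> \<chi> \<in> W i \<longrightarrow> (\<exists>m\<in>{i..<j}. \<psi> \<in> W m)) \<and>
      (\<forall>\<phi> \<psi>. \<chi> = Release \<phi> \<psi> \<and> \<chi> \<notin> W i \<longrightarrow> (\<exists>m\<in>{i..<j}. \<psi> \<notin> W m))" (is "\<forall>\<chi>\<in>S. eventually (?P \<chi>) _")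
  proof
    fix \<chi> assume "\<chi> \<in> S"
    have "\<exists>M. \<forall>j\<ge>M. ?P \<chi> j"
    proof (cases \<chi>)
      case (Until \<phi> \<psi>)
      then have "\<psi> \<in> S" using S[OF \<open>\<chi> \<in> S\<close>] subformulas_refl by auto
      show ?thesis
      proof (cases "\<chi> \<in> W i")
        case True
        then obtain k where "lsat G \<psi> \<pi> (i + k)" using Until by (auto simp: W_def)
        then have "\<psi> \<in> W (i + k)" using \<open>\<psi> \<in> S\<close> by (simp add: W_def)
        then have "\<exists>m\<in>{i..<j}. \<psi> \<in> W m" if "Suc (i + k) \<le> j" for j
          using that by (intro bexI[of _ "i + k"]) simp_all
        then have "?P \<chi> j" if "Suc (i + k) \<le> j" for j using that Until by simp
        then show ?thesis by blast
      qed (simp add: Until)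
    next
      case (Release \<phi> \<psi>)
      show ?thesis
      proof (cases "\<chi> \<in> W i")
        case False
        then obtain k where "\<not> lsat G \<psi> \<pi> (i + k)" using Release \<open>\<chi> \<in> S\<close> by (auto simp: W_def)
        then have "\<psi> \<notin> W (i + k)" by (simp add: W_def)
        then have "\<exists>m\<in>{i..<j}. \<psi> \<notin> W m" if "Suc (i + k) \<le> j" for j
          using that by (intro bexI[of _ "i + k"]) simp_all
        then have "?P \<chi> j" if "Suc (i + k) \<le> j" for j using that Release by simp
        then show ?thesis by blast
      qed (simp add: Release)
    qed auto
    then show "eventually (?P \<chi>) at_top" by (simp add: eventually_at_top_linorder)
  qed
  then have "\<forall>\<^sub>F j in at_top. \<forall>\<chi>\<in>S. ?P \<chi> j" by (intro eventually_ball_finite fin)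
  then obtain M where M: "\<And>j. M \<le> j \<Longrightarrow> \<forall>\<chi>\<in>S. ?P \<chi> j" unfolding eventually_at_top_linorder by blast
  have "\<exists>j>m. \<exists>k. fair_cycle G S (W i) \<pi> i j k" for m
  proof -
    obtain j where j: "j \<in> Y" "j > max m (max i M)" using Y(2) infinite_nat_iff_unbounded by blast
    obtain k where k: "k \<in> Y" "k > j" using Y(2) infinite_nat_iff_unbounded by blast
    have "foldr (regress G S) (segment \<pi> i j) (W i) = W i" "seen G S (segment \<pi> i j) (W i) = W ` {i..<j}"
      using run_segment[of 0 W G S \<pi> i j, OF regress] j Wi[OF j(1)] by simp_all
    moreover have "fair S (W i) (W ` {i..<j})"
    proof -
      have "W i \<subseteq> S" by (auto simp: W_def)
      then show ?thesis using M[of j] j unfolding fair_def by auto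
    qed
    ultimately have "fair_cycle G S (W i) \<pi> i j k" 
      using j k merge[OF i j(1) k(1)] unfolding fair_cycle_def by auto
    then show ?thesis using j by auto
  qed
  then have "\<exists>\<^sub>\<infinity>j. \<exists>k. fair_cycle G S (W i) \<pi> i j k" by (simp add: INFM_nat)
  moreover have "W i \<subseteq> S" by (auto simp: W_def)
  ultimately show ?thesis by blast
qed

text \<open>A guess confirmed infinitely often is right, and some guess is always so confirmed. This
  is the Sigma^0_3 form, since \<open>i\<close> and \<open>V\<close> range over a countable
  set.\<close>

lemma lsat_iff_fair_cycles:
  fixes \<phi> :: "('ap::finite, 'ag::finite, 'v) sl"
  defines "S \<equiv> subformulas \<phi>"
  shows "lsat G \<phi> \<pi> 0 \<longleftrightarrow> (\<exists>i. \<exists>V\<subseteq>S. \<phi> \<in> foldr (regress G S) (segment \<pi> 0 i) V \<and>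
    (\<exists>\<^sub>\<infinity>j. \<exists>k. fair_cycle G S V \<pi> i j k))"
  using fair_cycles_truth[of S _ G \<pi> _ \<phi>] fair_cycles_exist[of S G \<pi>]
    subformulas_trans[of _ \<phi>] subformulas_refl[of \<phi>] finite_subformulas[of \<phi>] unfolding S_def by meson

text \<open>Counts prefixes instead of cuts: a prefix qualifies if some \<open>j\<close> is
  confirmed there for the first time. Each \<open>j\<close> has at most one such prefix, and by
  \<open>bound\<close> it is longer than \<open>j\<close>, so neither set can be infinite without
  the other.\<close>

lemma INFM_confirmed:
  fixes R :: "nat \<Rightarrow> 'm list \<Rightarrow> bool"
  assumes mono: "\<And>j k l. R j (pre x k) \<Longrightarrow> k \<le> l \<Longrightarrow> R j (pre x l)"
    and bound: "\<And>j u. R j u \<Longrightarrow> j < length u"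
  shows "(\<exists>\<^sub>\<infinity>j. \<exists>k. R j (pre x k)) \<longleftrightarrow> (\<exists>\<^sub>\<infinity>k. \<exists>j. R j (pre x k) \<and> \<not> R j (butlast (pre x k)))"
    (is "?L \<longleftrightarrow> (\<exists>\<^sub>\<infinity>k. ?Q k)")
proof -
  have bl: "butlast (pre x k) = pre x (k - 1)" for k by (cases k) simp_all
  show ?thesis
  proof
    assume inf: ?L
    show "\<exists>\<^sub>\<infinity>k. ?Q k"
      unfolding INFM_nat
    proof
      fix m
      obtain j where j: "j > m" "\<exists>k. R j (pre x k)" using inf[unfolded INFM_nat, rule_format, of m] by blast
      then obtain k where k: "R j (pre x k)" "\<forall>l<k. \<not> R j (pre x l)"
        using exists_least_iff[of "\<lambda>k. R j (pre x k)"] by blast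
      have "j < k" using bound[OF k(1)] by simp
      with k have "?Q k" unfolding bl by (intro exI[of _ j]) simp
      then show "\<exists>k>m. ?Q k" using j(1) \<open>j < k\<close> less_trans by blast
    qed
  next
    assume inf: "\<exists>\<^sub>\<infinity>k. ?Q k"
    show ?L
    proof (rule ccontr)
      assume "\<not> ?L"
      then have "finite {j. \<exists>k. R j (pre x k)}" by (simp add: INFM_iff_infinite)
      moreover have "{k. ?Q k} \<subseteq> (\<lambda>j. LEAST k. R j (pre x k)) ` {j. \<exists>k. R j (pre x k)}"
      proof
        fix k assume "k \<in> {k. ?Q k}"
        then obtain j where j: "R j (pre x k)" "\<not> R j (pre x (k - 1))" unfolding bl by blast
        have "(LEAST k. R j (pre x k)) = k"
        proof (rule Least_equality)
          fix l assume "R j (pre x l)"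
          then show "k \<le> l" using j(2) mono[of j l "k - 1"] by (cases "l \<le> k - 1") auto
        qed (rule j(1))
        then show "k \<in> (\<lambda>j. LEAST k. R j (pre x k)) ` {j. \<exists>k. R j (pre x k)}" using j(1) by force
      qed
      ultimately have "finite {k. ?Q k}" by (rule finite_surj)
      then show False using inf by (simp add: INFM_iff_infinite)
    qed
  qed
qed

text \<open>In the game for a block of strategy quantifiers, the variables choose their actions one after
  the other, so that \<open>n\<close> consecutive moves make up one decision.\<close>

primrec states where
  "states G dec n s \<alpha> 0 = s"
| "states G dec n s \<alpha> (Suc r) = step G (states G dec n s \<alpha> r) (dec (segment \<alpha> (r * n) (Suc r * n)))"

lemma states_cong:
  assumes "\<And>i. i < r * n \<Longrightarrow> \<alpha> i = \<beta> i"
  shows "states G dec n s \<alpha> r = states G dec n s \<beta> r"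
  using assms
proof (induction r)
  case (Suc r)
  have "states G dec n s \<alpha> r = states G dec n s \<beta> r" using Suc.prems by (intro Suc.IH) simp
  moreover have "segment \<alpha> (r * n) (Suc r * n) = segment \<beta> (r * n) (Suc r * n)"
    by (rule map_cong) (use Suc.prems in auto)
  ultimately show ?case by (simp only: states.simps)
qed simp

lemma fair_cycle_cong:
  assumes "\<And>l. l < k \<Longrightarrow> \<pi> l = \<pi>' l"
  shows "fair_cycle G S V \<pi> i j k \<longleftrightarrow> fair_cycle G S V \<pi>' i j k"
proof (cases "i < j \<and> j \<le> k")
  case True
  have "segment \<pi> a b = segment \<pi>' a b" if "b \<le> k" for a b
    by (rule map_cong) (use assms that in auto)
  with True show ?thesis unfolding fair_cycle_def by (metis order_refl)
qed (auto simp: fair_cycle_def)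

lemma lsat_game_determined:
  fixes G :: "('ap::finite, 'ag::finite, 'ac::countable, 'st::countable) cgs"
    and \<phi> :: "('ap, 'ag, 'v) sl"
  assumes n: "n > 0"
  shows "(\<exists>\<sigma>. \<forall>\<alpha>. (\<forall>k. I (pre \<alpha> k) \<longrightarrow> \<alpha> k = \<sigma> (pre \<alpha> k)) \<longrightarrow> lsat G \<phi> (states G dec n s \<alpha>) 0) \<or>
    (\<exists>\<sigma>. \<forall>\<alpha>. (\<forall>k. \<not> I (pre \<alpha> k) \<longrightarrow> \<alpha> k = \<sigma> (pre \<alpha> k)) \<longrightarrow> \<not> lsat G \<phi> (states G dec n s \<alpha>) 0)"
proof -
  let ?S = "subformulas \<phi>"
  let ?st = "states G dec n s"
  \<comment> \<open>The list \<open>u\<close> is read as a total function;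
    \<open>k * n < length u\<close> ensures that the states up to \<open>k\<close> depend on actual
    moves only, and its strictness gives \<open>j < length u\<close>.\<close>
  define R where "R i V j u \<longleftrightarrow> (\<exists>k. k * n < length u \<and>
    \<phi> \<in> foldr (regress G ?S) (segment (?st ((!) u)) 0 i) V \<and> fair_cycle G ?S V (?st ((!) u)) i j k)" for i V j u
  have R_pre: "R i V j (pre \<alpha> m) \<longleftrightarrow> (\<exists>k. k * n < m \<and>
    \<phi> \<in> foldr (regress G ?S) (segment (?st \<alpha>) 0 i) V \<and> fair_cycle G ?S V (?st \<alpha>) i j k)" for i V j \<alpha> m
  proof -
    have *: "?st ((!) (pre \<alpha> m)) l = ?st \<alpha> l" if "k * n < m" "l \<le> k" for k l
    proof (rule states_cong)
      fix i assume "i < l * n"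
      also have "\<dots> \<le> k * n" using that(2) by simp
      finally show "pre \<alpha> m ! i = \<alpha> i" using that(1) by simp
    qed
    have "segment (?st ((!) (pre \<alpha> m))) 0 i = segment (?st \<alpha>) 0 i" if "k * n < m" "i \<le> k" for k
      by (rule map_cong) (use *[OF that(1)] that(2) in auto)
    moreover have "fair_cycle G ?S V (?st ((!) (pre \<alpha> m))) i j k \<longleftrightarrow> fair_cycle G ?S V (?st \<alpha>) i j k"
      if "k * n < m" for k
      by (rule fair_cycle_cong) (use *[OF that] in auto)
    moreover have "i \<le> k" if "fair_cycle G ?S V \<pi> i j k" for k \<pi>
      using that by (simp add: fair_cycle_def)
    ultimately show ?thesis unfolding R_def by (metis length_map length_upt diff_zero)
  qed
  have R_bound: "j < length u" if R: "R i V j u" for i V j u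
  proof -
    obtain k where "k * n < length u" "j \<le> k" using R unfolding R_def fair_cycle_def by blast
    moreover have "k \<le> k * n" using n by simp
    ultimately show ?thesis by linarith
  qed
  have R_ex: "(\<exists>m. R i V j (pre \<alpha> m)) \<longleftrightarrow>
    \<phi> \<in> foldr (regress G ?S) (segment (?st \<alpha>) 0 i) V \<and> (\<exists>k. fair_cycle G ?S V (?st \<alpha>) i j k)" for i V j \<alpha>
    unfolding R_pre by blast
  define e where "e = from_nat_into ((UNIV :: nat set) \<times> Pow ?S)"
  have e: "range e = UNIV \<times> Pow ?S"
  proof -
    have "countable (UNIV \<times> Pow ?S :: (nat \<times> _) set)"
      by (rule countable_SIGMA) (simp_all add: countable_finite finite_subformulas)
    then show ?thesis unfolding e_def by (intro range_from_nat_into) auto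
  qed
  define P where "P m u \<longleftrightarrow> (\<exists>j. R (fst (e m)) (snd (e m)) j u \<and> \<not> R (fst (e m)) (snd (e m)) j (butlast u))" for m u
  have "lsat G \<phi> (?st \<alpha>) 0 \<longleftrightarrow> (\<exists>m. \<exists>\<^sub>\<infinity>k. P m (pre \<alpha> k))" for \<alpha>
  proof -
    have "lsat G \<phi> (?st \<alpha>) 0 \<longleftrightarrow> (\<exists>(i, V)\<in>UNIV \<times> Pow ?S. \<exists>\<^sub>\<infinity>j. \<exists>m. R i V j (pre \<alpha> m))"
      unfolding lsat_iff_fair_cycles R_ex by auto
    also have "\<dots> \<longleftrightarrow> (\<exists>m. \<exists>\<^sub>\<infinity>j. \<exists>k. R (fst (e m)) (snd (e m)) j (pre \<alpha> k))"
      unfolding e[symmetric] by (simp add: case_prod_beta)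
    also have "\<dots> \<longleftrightarrow> (\<exists>m. \<exists>\<^sub>\<infinity>k. P m (pre \<alpha> k))"
    proof -
      have "(\<exists>\<^sub>\<infinity>j. \<exists>k. R i V j (pre \<alpha> k)) \<longleftrightarrow> (\<exists>\<^sub>\<infinity>k. \<exists>j. R i V j (pre \<alpha> k) \<and> \<not> R i V j (butlast (pre \<alpha> k)))" for i V
      proof (rule INFM_confirmed)
        fix j k l assume "R i V j (pre \<alpha> k)" "k \<le> l"
        then show "R i V j (pre \<alpha> l)" unfolding R_pre by (meson less_le_trans)
      qed (rule R_bound)
      then show ?thesis unfolding P_def by simp
    qed
    finally show ?thesis .
  qed
  then show ?thesis
    using game.Sigma3_determinacy[of "{\<alpha>. lsat G \<phi> (?st \<alpha>) 0}" P I] by simp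
qed

section \<open>From strategy logic to LTL and back\<close>

lemma sat_cong:
  "(\<And>l. l \<in> free \<phi> \<Longrightarrow> \<chi> l = \<chi>' l) \<Longrightarrow> sat G \<phi> \<chi> s \<longleftrightarrow> sat G \<phi> \<chi>' s"
proof (induction \<phi> arbitrary: \<chi> \<chi>' s)
  case (Conj \<phi> \<psi>)
  have "sat G \<phi> \<chi> s \<longleftrightarrow> sat G \<phi> \<chi>' s" "sat G \<psi> \<chi> s \<longleftrightarrow> sat G \<psi> \<chi>' s"
    using Conj.prems by (intro Conj.IH; simp)+
  then show ?case by simp
next
  case (Disj \<phi> \<psi>)
  have "sat G \<phi> \<chi> s \<longleftrightarrow> sat G \<phi> \<chi>' s" "sat G \<psi> \<chi> s \<longleftrightarrow> sat G \<psi> \<chi>' s"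
    using Disj.prems by (intro Disj.IH; simp)+
  then show ?case by simp
next
  case (Neg \<phi>)
  have "sat G \<phi> \<chi> s \<longleftrightarrow> sat G \<phi> \<chi>' s" using Neg.prems by (intro Neg.IH; simp)
  then show ?case by simp
next
  case (Next \<phi>)
  have agents: "\<chi> (Inr a) = \<chi>' (Inr a)" for a using Next.prems by simp
  then have "complete \<chi> = complete \<chi>'" by (auto simp: complete_def dom_def)
  moreover have "play_prefix G \<chi> s i = play_prefix G \<chi>' s i" for i
    by (induction i) (simp_all add: agents)
  moreover have "sat G \<phi> (translate \<rho> \<chi>) s \<longleftrightarrow> sat G \<phi> (translate \<rho> \<chi>') s" for \<rho> s
    using Next.prems by (intro Next.IH) (simp add: translate_def)
  ultimately show ?case by (simp add: agents)
next
  case (Until \<phi> \<psi>)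
  have agents: "\<chi> (Inr a) = \<chi>' (Inr a)" for a using Until.prems by simp
  then have "complete \<chi> = complete \<chi>'" by (auto simp: complete_def dom_def)
  moreover have "play_prefix G \<chi> s i = play_prefix G \<chi>' s i" for i
    by (induction i) (simp_all add: agents)
  moreover have "sat G \<phi> (translate \<rho> \<chi>) s \<longleftrightarrow> sat G \<phi> (translate \<rho> \<chi>') s"
    "sat G \<psi> (translate \<rho> \<chi>) s \<longleftrightarrow> sat G \<psi> (translate \<rho> \<chi>') s" for \<rho> s
    using Until.prems by (intro Until.IH; simp add: translate_def)+
  ultimately show ?case by (simp add: Let_def)
next
  case (Release \<phi> \<psi>)
  have agents: "\<chi> (Inr a) = \<chi>' (Inr a)" for a using Release.prems by simp
  then have "complete \<chi> = complete \<chi>'" by (auto simp: complete_def dom_def)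
  moreover have "play_prefix G \<chi> s i = play_prefix G \<chi>' s i" for i
    by (induction i) (simp_all add: agents)
  moreover have "sat G \<phi> (translate \<rho> \<chi>) s \<longleftrightarrow> sat G \<phi> (translate \<rho> \<chi>') s"
    "sat G \<psi> (translate \<rho> \<chi>) s \<longleftrightarrow> sat G \<psi> (translate \<rho> \<chi>') s" for \<rho> s
    using Release.prems by (intro Release.IH; simp add: translate_def)+
  ultimately show ?case by (simp add: Let_def)
next
  case (ExStr x \<phi>)
  have "sat G \<phi> (\<chi>(Inl x \<mapsto> f)) s \<longleftrightarrow> sat G \<phi> (\<chi>'(Inl x \<mapsto> f)) s" for f
    using ExStr.prems by (intro ExStr.IH) auto
  then show ?case by simp
next
  case (AllStr x \<phi>)
  have "sat G \<phi> (\<chi>(Inl x \<mapsto> f)) s \<longleftrightarrow> sat G \<phi> (\<chi>'(Inl x \<mapsto> f)) s" for f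
    using AllStr.prems by (intro AllStr.IH) auto
  then show ?case by simp
next
  case (Bind a x \<phi>)
  have "sat G \<phi> (\<chi>(Inr a := \<chi> (Inl x))) s \<longleftrightarrow> sat G \<phi> (\<chi>'(Inr a := \<chi>' (Inl x))) s"
    using Bind.prems by (intro Bind.IH) (auto split: if_splits)
  then show ?case by simp
qed simp

section \<open>Free variables and agents of OGSL formulas\<close>

lemma free_quantify1: "free (quantify1 Q \<phi>) = free \<phi> - {Inl (qvar Q)}"
  by (cases Q) simp_all

lemma free_quantify: "free (quantify q \<phi>) = free \<phi> - Inl ` qvar ` set q"
  by (induction q) (auto simp: quantify_def free_quantify1)

lemma free_bind_sentence: "free \<phi> = {} \<Longrightarrow> free (bind b \<phi>) = {}"
  by (induction b) (auto simp: bind_def)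

lemma free_bind:
  "distinct (map fst b) \<Longrightarrow> free \<phi> = range Inr \<Longrightarrow>
    free (bind b \<phi>) = Inl ` snd ` set b \<union> Inr ` (- fst ` set b)"
proof (induction b)
  case (Cons ax b)
  obtain a x where [simp]: "ax = (a, x)" by force
  have "free (bind b \<phi>) = Inl ` snd ` set b \<union> Inr ` (- fst ` set b)" using Cons by simp
  moreover have "a \<notin> fst ` set b" using Cons.prems(1) by simp
  ultimately show ?case by (auto simp: bind_def)
qed (simp add: bind_def)

lemma free_block:
  assumes "free \<phi> = {} \<or> free \<phi> = range Inr" "binding_prefix b"
    and "quantification_prefix {x. Inl x \<in> free (bind b \<phi>)} q"
  shows "free (quantify q (bind b \<phi>)) = {}"
proof -
  have "free (bind b \<phi>) \<subseteq> range Inl"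
    using assms(1,2) free_bind[of b \<phi>] free_bind_sentence[of \<phi> b] by (auto simp: binding_prefix_def)
  then show ?thesis using assms(3) by (auto simp: free_quantify quantification_prefix_def)
qed

text \<open>A binding prefix covers all agents and the quantifiers above it all its variables, so a
  block is closed; a temporal operator frees all agents at once. Nothing in between can
  arise.\<close>

lemma ogsl_free: "ogsl \<phi> \<Longrightarrow> free \<phi> = {} \<or> free \<phi> = range Inr"
  by (induction rule: ogsl.induct) (auto simp: free_block)

lemma lsat_block:
  assumes "binding_prefix b"
  shows "lsat G (quantify q (bind b \<phi>)) \<pi> i \<longleftrightarrow> sat G (quantify q (bind b \<phi>)) Map.empty (\<pi> i)"
proof (cases q)
  case Nil
  \<comment> \<open>Types are nonempty, so there is an agent to bind. Without quantifiers the block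
    starts with \<open>Bind\<close>, which \<open>lsat\<close> also treats as an atom.\<close>
  have "b \<noteq> []" using assms by (auto simp: binding_prefix_def)
  then show ?thesis using Nil by (cases b) (auto simp: quantify_def bind_def)
next
  case (Cons Q q')
  then show ?thesis by (cases Q) (simp_all add: quantify_def)
qed

lemma lsat_shift: "lsat G \<phi> (\<lambda>k. \<pi> (i + k)) j \<longleftrightarrow> lsat G \<phi> \<pi> (i + j)"
  by (induction \<phi> arbitrary: j) (simp_all add: add.assoc)

section \<open>Plays, their translation and LTL truth\<close>

lemma play_prefix_not_Nil: "play_prefix G \<chi> s i \<noteq> []"
  by (cases i) (simp_all add: Let_def)

lemma hd_play_prefix: "hd (play_prefix G \<chi> s i) = s"
  by (induction i) (simp_all add: Let_def hd_append play_prefix_not_Nil)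

lemma track_snoc: "track G \<rho> \<Longrightarrow> track G (\<rho> @ [step G (last \<rho>) d])"
  unfolding track_def by (auto simp: nth_append last_conv_nth less_Suc_eq)
    (metis diff_Suc_Suc diff_zero)

lemma track_play_prefix: "track G (play_prefix G \<chi> s i)"
proof (induction i)
  case (Suc i)
  then show ?case by (simp add: Let_def track_snoc)
qed (simp add: track_def)

lemma play_prefix_translate:
  assumes "complete \<chi>"
    and \<rho>_def: "\<rho> = play_prefix G \<chi> s i"
  shows "play_prefix G \<chi> s (i + k) = \<rho> @ tl (play_prefix G (translate \<rho> \<chi>) (last \<rho>) k)"
proof (induction k)
  case (Suc k)
  let ?\<rho>' = "play_prefix G (translate \<rho> \<chi>) (last \<rho>) k"
  have ne: "?\<rho>' \<noteq> []" "hd ?\<rho>' = last \<rho>" by (simp_all add: play_prefix_not_Nil hd_play_prefix)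
  then have l: "last (\<rho> @ tl ?\<rho>') = last ?\<rho>'" by (cases ?\<rho>') auto
  have "the (the (translate \<rho> \<chi> (Inr a)) ?\<rho>') = the (the (\<chi> (Inr a)) (\<rho> @ tl ?\<rho>'))" for a
  proof -
    obtain f where "\<chi> (Inr a) = Some f" using assms(1) by (auto simp: complete_def dom_def)
    then show ?thesis using ne by (simp add: translate_def translate_strategy_def)
  qed
  then show ?case using Suc ne l by (simp add: Let_def)
qed (simp add: \<rho>_def)

text \<open>Strategies matter only through the play they induce: a translated assignment generates a
  suffix of the same play, and a block ignores the assignment because it is closed.\<close>

lemma sat_iff_lsat:
  "ogsl \<phi> \<Longrightarrow> complete \<chi> \<Longrightarrow> sat G \<phi> \<chi> s \<longleftrightarrow> lsat G \<phi> (\<lambda>k. last (play_prefix G \<chi> s k)) 0"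
proof (induction arbitrary: \<chi> s rule: ogsl.induct)
  have *: "sat G \<phi> (translate (play_prefix G \<chi> s i) \<chi>) (last (play_prefix G \<chi> s i)) \<longleftrightarrow>
      lsat G \<phi> (\<lambda>k. last (play_prefix G \<chi> s k)) i"
    if c: "complete \<chi>" and IH: "\<And>\<chi> s. complete \<chi> \<Longrightarrow>
      sat G \<phi> \<chi> s \<longleftrightarrow> lsat G \<phi> (\<lambda>k. last (play_prefix G \<chi> s k)) 0" for \<phi> \<chi> s i
  proof -
    let ?\<rho> = "play_prefix G \<chi> s i"
    let ?\<rho>' = "play_prefix G (translate ?\<rho> \<chi>) (last ?\<rho>)"
    have "complete (translate ?\<rho> \<chi>)" using c by (auto simp: complete_def translate_def dom_def)
    moreover have "last (?\<rho>' k) = last (play_prefix G \<chi> s (i + k))" for k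
    proof -
      have "?\<rho>' k \<noteq> []" "hd (?\<rho>' k) = last ?\<rho>" by (simp_all add: play_prefix_not_Nil hd_play_prefix)
      then show ?thesis unfolding play_prefix_translate[OF c refl] by (cases "?\<rho>' k") auto
    qed
    ultimately show ?thesis
      using IH lsat_shift[of G \<phi> "\<lambda>k. last (play_prefix G \<chi> s k)" i 0] by simp
  qed
  {
    case (5 \<phi>)
    then show ?case using *[OF "5.prems" "5.IH", of s 1] by simp
  next
    case (6 \<phi> \<psi>)
    then show ?case using *[OF "6.prems" "6.IH"(1), of s] *[OF "6.prems" "6.IH"(2), of s] by (simp add: Let_def)
  next
    case (7 \<phi> \<psi>)
    then show ?case using *[OF "7.prems" "7.IH"(1), of s] *[OF "7.prems" "7.IH"(2), of s] by (simp add: Let_def)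
  next
    case (8 \<phi> b q)
    have "free (quantify q (bind b \<phi>)) = {}" using free_block[OF ogsl_free] "8.hyps" by blast
    then have "sat G (quantify q (bind b \<phi>)) \<chi> s \<longleftrightarrow> sat G (quantify q (bind b \<phi>)) Map.empty s"
      by (intro sat_cong) simp
    then show ?case using 8 by (simp add: lsat_block)
  }
qed simp_all

text \<open>A closed formula has no temporal operator outside its blocks, since such an operator
  frees all agents. Hence only the state at \<open>i\<close> matters.\<close>

lemma sat_iff_lsat_sentence:
  "ogsl \<phi> \<Longrightarrow> free \<phi> = {} \<Longrightarrow> sat G \<phi> \<chi> (\<pi> i) \<longleftrightarrow> lsat G \<phi> \<pi> i"
proof (induction rule: ogsl.induct)
  case (8 \<phi> b q)
  then have "sat G (quantify q (bind b \<phi>)) \<chi> (\<pi> i) \<longleftrightarrow> sat G (quantify q (bind b \<phi>)) Map.empty (\<pi> i)"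
    by (intro sat_cong) simp
  then show ?case using 8 by (simp add: lsat_block)
qed auto

section \<open>Blocks of strategy quantifiers\<close>

primrec is_ex :: "'v quantifier \<Rightarrow> bool" where
  "is_ex (Exists x) = True"
| "is_ex (Forall x) = False"

text \<open>The parameter \<open>v\<close> is the value that the proponent aims for: the existentially quantified
  variables play for \<open>True\<close>, the universally quantified ones for \<open>False\<close>.\<close>

lemma sat_quantify1_own:
  assumes "is_ex Q = v" "total_strategy G s f" "sat G \<phi> (\<chi>(Inl (qvar Q) \<mapsto> f)) s = v"
  shows "sat G (quantify1 Q \<phi>) \<chi> s = v"
  using assms by (cases Q) auto

lemma total_strategy_ex: "\<exists>f. total_strategy G s f"
  by (rule exI[of _ "\<lambda>\<rho>. if track G \<rho> \<and> hd \<rho> = s then Some undefined else None"])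
    (auto simp: total_strategy_def dom_def)

lemma sat_quantify1_other:
  assumes "is_ex Q \<noteq> v" "\<And>f. total_strategy G s f \<Longrightarrow> sat G \<phi> (\<chi>(Inl (qvar Q) \<mapsto> f)) s = v"
  shows "sat G (quantify1 Q \<phi>) \<chi> s = v"
  using assms total_strategy_ex[of G s] by (cases Q) auto

text \<open>\<open>c\<close> acts as a family of Skolem functions for the proponent, and
  \<open>local\<close> says that a choice reads only the strategies quantified before it. The
  induction adds quantifiers from the innermost outwards, with \<open>F\<close> holding the
  strategies already fixed further out.\<close>

lemma sat_quantify_value:
  fixes c :: "nat \<Rightarrow> (nat \<Rightarrow> ('ac::countable, 'st::countable) strategy) \<Rightarrow> ('ac, 'st) strategy"
  assumes dist: "distinct (map qvar q)"
    and total: "\<And>j F. total_strategy G s (c j F)"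
    and local: "\<And>j F F'. (\<And>l. l < j \<Longrightarrow> F l = F' l) \<Longrightarrow> c j F = c j F'"
    and body: "\<And>F \<chi>. (\<And>j. j < length q \<Longrightarrow> \<chi> (Inl (qvar (q ! j))) = Some (F j)) \<Longrightarrow>
      (\<And>j. j < length q \<Longrightarrow> is_ex (q ! j) = v \<Longrightarrow> F j = c j F) \<Longrightarrow> sat G \<psi> \<chi> s = v"
  shows "i \<le> length q \<Longrightarrow> (\<And>j. j < i \<Longrightarrow> \<chi> (Inl (qvar (q ! j))) = Some (F j)) \<Longrightarrow>
    (\<And>j. j < i \<Longrightarrow> is_ex (q ! j) = v \<Longrightarrow> F j = c j F) \<Longrightarrow> sat G (quantify (drop i q) \<psi>) \<chi> s = v"
proof (induction i arbitrary: \<chi> F rule: inc_induct)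
  case base
  then show ?case using body by (simp add: quantify_def)
next
  case (step i)
  have q: "quantify (drop i q) \<psi> = quantify1 (q ! i) (quantify (drop (Suc i) q) \<psi>)"
    using step(2) by (simp add: quantify_def flip: Cons_nth_drop_Suc)
  have rec: "sat G (quantify (drop (Suc i) q) \<psi>) (\<chi>(Inl (qvar (q ! i)) \<mapsto> f)) s = v"
    if f: "is_ex (q ! i) = v \<Longrightarrow> f = c i F" for f
  proof (rule step.IH)
    fix j assume j: "j < Suc i"
    show "(\<chi>(Inl (qvar (q ! i)) \<mapsto> f)) (Inl (qvar (q ! j))) = Some ((F(i := f)) j)"
    proof (cases "j = i")
      case False
      then have "qvar (q ! j) \<noteq> qvar (q ! i)"
        using dist step(2) j by (auto simp: distinct_conv_nth)
      then show ?thesis using False j step.prems(1) by simp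
    qed simp
    assume "is_ex (q ! j) = v"
    moreover have "c j (F(i := f)) = c j F" by (rule local) (use j in auto)
    ultimately show "(F(i := f)) j = c j (F(i := f))" using f step.prems(2) j by (cases "j = i") auto
  qed
  show ?case
    unfolding q
    using sat_quantify1_own[OF _ total rec] sat_quantify1_other[OF _ rec] by blast
qed

text \<open>The argument is a reversed track.\<close>

primrec representative where
  "representative pick [] = []"
| "representative pick (x # r) =
    (if r = [] then [] else representative pick r @ pick (representative pick r) (hd r) x)"

section \<open>Bindings, decisions and the value of a block\<close>

definition rebind where
  "rebind b \<chi> = (\<lambda>l. case l of Inl x \<Rightarrow> \<chi> (Inl x) | Inr a \<Rightarrow>
    (case map_of b a of None \<Rightarrow> \<chi> (Inr a) | Some x \<Rightarrow> \<chi> (Inl x)))"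

lemma sat_bind: "distinct (map fst b) \<Longrightarrow> sat G (bind b \<phi>) \<chi> s \<longleftrightarrow> sat G \<phi> (rebind b \<chi>) s"
proof (induction b arbitrary: \<chi>)
  case Nil
  have "rebind [] \<chi> = \<chi>" by (auto simp: rebind_def split: sum.split)
  then show ?case by (simp add: bind_def)
next
  case (Cons ax b)
  obtain a x where ax: "ax = (a, x)" by force
  have "rebind b (\<chi>(Inr a := \<chi> (Inl x))) = rebind (ax # b) \<chi>"
  proof
    fix l
    have "map_of b a = None" using Cons.prems by (simp add: ax map_of_eq_None_iff)
    then show "rebind b (\<chi>(Inr a := \<chi> (Inl x))) l = rebind (ax # b) \<chi> l"
      by (auto simp: rebind_def ax split: sum.split option.split)
  qed
  then show ?case using Cons by (simp add: bind_def ax)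
qed

text \<open>\<open>u\<close> is one round of the game, with one action per quantified variable;
  agents bound to the same variable share its action.\<close>

definition decision_of :: "'v quantifier list \<Rightarrow> ('ag \<times> 'v) list \<Rightarrow> 'ac list \<Rightarrow> 'ag \<Rightarrow> 'ac" where
  "decision_of q b u = (\<lambda>a. u ! (THE i. i < length q \<and> qvar (q ! i) = the (map_of b a)))"

lemma decision_of_nth:
  assumes "distinct (map qvar q)" "map_of b a = Some (qvar (q ! i))" "i < length q"
  shows "decision_of q b u a = u ! i"
proof -
  have "(THE j. j < length q \<and> qvar (q ! j) = the (map_of b a)) = i"
    using assms by (intro the_equality) (auto simp: distinct_conv_nth)
  then show ?thesis by (simp add: decision_of_def)
qed

text \<open>A track hides only past rounds. In the current round the actions of the variables
  quantified earlier are read off their strategies, so a choice combines the representative past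
  with the actual present. The representative history visits the states of the actual play, and
  \<open>lsat\<close> sees nothing else.\<close>

lemma sat_block_value:
  fixes G :: "('ap::finite, 'ag::finite, 'ac::countable, 'st::countable) cgs"
    and \<phi> :: "('ap, 'ag, 'v) sl"
  defines "st \<equiv> \<lambda>q b. states G (decision_of q b) (length q)"
  assumes \<phi>: "ogsl \<phi>" and b: "binding_prefix b" and dist: "distinct (map qvar q)"
    and vars: "snd ` set b = set (map qvar q)"
    and \<sigma>: "\<And>\<alpha>. (\<And>k. is_ex (q ! (k mod length q)) = v \<Longrightarrow> \<alpha> k = \<sigma> (pre \<alpha> k)) \<Longrightarrow>
      lsat G \<phi> (st q b s \<alpha>) 0 = v"
  shows "sat G (quantify q (bind b \<phi>)) \<chi> s = v"
proof -
  let ?n = "length q"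
  let ?dec = "decision_of q b :: 'ac list \<Rightarrow> 'ag \<Rightarrow> 'ac"
  define legal where "legal h u \<longleftrightarrow> length u = ?n \<and>
    (\<forall>i<?n. is_ex (q ! i) = v \<longrightarrow> u ! i = \<sigma> (h @ take i u))" for h u
  \<comment> \<open>The choice depends on \<open>\<sigma>\<close> only, not on the opponent's strategies, so that all own strategies can
    share it; the actions it assigns to the opponent may differ from those actually played.\<close>
  define pick where "pick h x x' = (SOME u. legal h u \<and> step G x (?dec u) = x')" for h x x'
  define rep where "rep \<rho> = representative pick (rev \<rho>)" for \<rho>
  define acts where "acts F \<rho> j = map (\<lambda>l. the (F l \<rho>)) [0..<j]" for F :: "nat \<Rightarrow> ('ac, 'st) strategy" and \<rho> j
  define c where "c j F = (\<lambda>\<rho>. if track G \<rho> \<and> hd \<rho> = s then Some (\<sigma> (rep \<rho> @ acts F \<rho> j)) else None)" for j F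
  have "b \<noteq> []" using b by (auto simp: binding_prefix_def)
  then have n: "?n > 0" using vars by auto
  have db: "distinct (map fst b)" using b by (simp add: binding_prefix_def)
  have "sat G (quantify (drop 0 q) (bind b \<phi>)) \<chi> s = v"
  proof (rule sat_quantify_value[where c = c and F = "\<lambda>_ _. None"])
    show "total_strategy G s (c j F)" for j F by (auto simp: total_strategy_def c_def dom_def)
    show "c j F = c j F'" if "\<And>l. l < j \<Longrightarrow> F l = F' l" for j F F'
    proof -
      have "acts F \<rho> j = acts F' \<rho> j" for \<rho> using that by (simp add: acts_def)
      then show ?thesis by (simp add: c_def cong: if_cong)
    qed
  next
    fix F and \<chi> :: "('v, 'ag, 'ac, 'st) assignment"
    assume \<chi>: "\<And>j. j < ?n \<Longrightarrow> \<chi> (Inl (qvar (q ! j))) = Some (F j)"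
      and F: "\<And>j. j < ?n \<Longrightarrow> is_ex (q ! j) = v \<Longrightarrow> F j = c j F"
    let ?\<chi> = "rebind b \<chi>"
    have agent: "\<exists>i<?n. map_of b a = Some (qvar (q ! i)) \<and> ?\<chi> (Inr a) = Some (F i)" for a
    proof -
      have "a \<in> fst ` set b" using b by (simp add: binding_prefix_def)
      then obtain x where x: "map_of b a = Some x" by (metis map_of_eq_None_iff not_Some_eq)
      then have "x \<in> snd ` set b" by (metis map_of_SomeD image_eqI snd_conv)
      then obtain i where "i < ?n" "x = qvar (q ! i)" unfolding vars by (auto simp: in_set_conv_nth)
      then show ?thesis using x \<chi> by (auto simp: rebind_def)
    qed
    then have compl: "complete ?\<chi>" by (force simp: complete_def dom_def)
    let ?\<rho> = "play_prefix G ?\<chi> s"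
    define u where "u k = acts F (?\<rho> k) ?n" for k
    have u_len: "length (u k) = ?n" for k by (simp add: u_def acts_def)
    have u: "?dec (u k) = (\<lambda>a. the (the (?\<chi> (Inr a)) (?\<rho> k)))" for k
    proof
      fix a
      obtain i where i: "i < ?n" "map_of b a = Some (qvar (q ! i))" "?\<chi> (Inr a) = Some (F i)"
        using agent by blast
      have "?dec (u k) a = u k ! i" by (rule decision_of_nth[OF dist i(2,1)])
      then show "?dec (u k) a = the (the (?\<chi> (Inr a)) (?\<rho> k))"
        using i by (simp add: u_def acts_def)
    qed
    have legal: "legal (rep (?\<rho> k)) (u k)" for k
      unfolding legal_def
    proof (intro conjI allI impI)
      fix i assume i: "i < ?n" "is_ex (q ! i) = v"
      have "u k ! i = the (c i F (?\<rho> k))" using i F by (simp add: u_def acts_def)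
      also have "\<dots> = \<sigma> (rep (?\<rho> k) @ acts F (?\<rho> k) i)"
        by (simp add: c_def track_play_prefix hd_play_prefix)
      also have "acts F (?\<rho> k) i = take i (u k)" using i(1) by (simp add: u_def acts_def take_map)
      finally show "u k ! i = \<sigma> (rep (?\<rho> k) @ take i (u k))" .
    qed (rule u_len)
    have \<rho>_Suc: "?\<rho> (Suc k) = ?\<rho> k @ [step G (last (?\<rho> k)) (?dec (u k))]" for k
      by (simp add: Let_def u)
    define w where "w k = pick (rep (?\<rho> k)) (last (?\<rho> k)) (last (?\<rho> (Suc k)))" for k
    \<comment> \<open>The round actually played is legal and leads to the required successor, so the
      choice in \<open>pick\<close> is possible.\<close>
    have "legal (rep (?\<rho> k)) (w k) \<and> step G (last (?\<rho> k)) (?dec (w k)) = last (?\<rho> (Suc k))" for k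
      unfolding w_def pick_def
      by (rule someI[where x = "u k"]) (use legal \<rho>_Suc in simp)
    then have w: "legal (rep (?\<rho> k)) (w k)" "step G (last (?\<rho> k)) (?dec (w k)) = last (?\<rho> (Suc k))" for k
      by blast+
    have w_len: "length (w k) = ?n" for k using w(1) by (simp add: legal_def)
    have rep_Suc: "rep (?\<rho> (Suc k)) = rep (?\<rho> k) @ w k" for k
    proof -
      have "rep (?\<rho> k @ [x]) = rep (?\<rho> k) @ pick (rep (?\<rho> k)) (last (?\<rho> k)) x" for x
        by (simp add: rep_def play_prefix_not_Nil hd_rev)
      then show ?thesis unfolding w_def \<rho>_Suc by simp
    qed
    \<comment> \<open>The representative rounds are strung together. It is this sequence, rather
      than that of the actual moves, that is shown to follow \<open>\<sigma>\<close>.\<close>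
    define \<alpha> where "\<alpha> m = w (m div ?n) ! (m mod ?n)" for m
    have seg: "segment \<alpha> (k * ?n) (k * ?n + i) = take i (w k)" if "i \<le> ?n" for k i
    proof (rule nth_equalityI)
      fix l assume "l < length (segment \<alpha> (k * ?n) (k * ?n + i))"
      then have "l < i" by simp
      moreover from this have "(k * ?n + l) div ?n = k" "(k * ?n + l) mod ?n = l" using that n by simp_all
      ultimately show "segment \<alpha> (k * ?n) (k * ?n + i) ! l = take i (w k) ! l" by (simp add: \<alpha>_def)
    qed (use that w_len in simp)
    have seg': "segment \<alpha> (k * ?n) (Suc k * ?n) = w k" for k
      using seg[of ?n k] w_len[of k] by (simp add: add.commute)
    have rep: "pre \<alpha> (k * ?n) = rep (?\<rho> k)" for k
    proof (induction k)
      case (Suc k)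
      have "pre \<alpha> (Suc k * ?n) = pre \<alpha> (k * ?n) @ segment \<alpha> (k * ?n) (Suc k * ?n)"
        by (rule segment_append) simp_all
      then show ?case unfolding Suc seg' rep_Suc .
    qed (simp add: rep_def)
    have "lsat G \<phi> (st q b s \<alpha>) 0 = v"
    proof (rule \<sigma>)
      fix m assume m: "is_ex (q ! (m mod ?n)) = v"
      define k i where "k = m div ?n" and "i = m mod ?n"
      have i: "i < ?n" and mi: "m = k * ?n + i" using n by (simp_all add: k_def i_def)
      have "pre \<alpha> m = pre \<alpha> (k * ?n) @ segment \<alpha> (k * ?n) m"
        unfolding mi by (rule segment_append) simp_all
      also have "\<dots> = rep (?\<rho> k) @ take i (w k)" using seg[of i k] i by (simp add: rep mi)
      finally have "pre \<alpha> m = rep (?\<rho> k) @ take i (w k)" .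
      moreover have "w k ! i = \<sigma> (rep (?\<rho> k) @ take i (w k))"
        using w(1)[of k] i m unfolding legal_def i_def by blast
      ultimately show "\<alpha> m = \<sigma> (pre \<alpha> m)" by (simp add: \<alpha>_def k_def i_def)
    qed
    moreover have "st q b s \<alpha> k = last (?\<rho> k)" for k
    proof (induction k)
      case (Suc k)
      then show ?case unfolding st_def states.simps seg' w(2)[symmetric] by simp
    qed (simp add: st_def)
    then have "st q b s \<alpha> = (\<lambda>k. last (?\<rho> k))" by blast
    ultimately show "sat G (bind b \<phi>) \<chi> s = v"
      using sat_bind[OF db, of G \<phi> \<chi> s] sat_iff_lsat[OF \<phi> compl, of G s] by simp
  qed (use dist in auto)
  then show ?thesis by simp
qed

text \<open>For a block, both games have the same moves and, by induction on the body, the same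
  winning action sequences. So the winner and the strategy found for \<open>G\<close> serve the tree
  as well.\<close>

lemma lsat_unwinding:
  fixes G :: "('ap::finite, 'ag::finite, 'ac::countable, 'st::countable) cgs"
    and T :: "('ap, 'ag, 'ac, ('ag, 'ac) decision list) cgs"
  assumes unw: "unwinding_map G T unw"
  shows "ogsl \<phi> \<Longrightarrow> lsat T \<phi> \<pi> i \<longleftrightarrow> lsat G \<phi> (unw \<circ> \<pi>) i"
proof (induction arbitrary: \<pi> i rule: ogsl.induct)
  case (1 p)
  then show ?case using unw by (simp add: unwinding_map_def)
next
  case (8 \<phi> b q)
  have db: "distinct (map fst b)" and all: "fst ` set b = UNIV"
    using "8.hyps" by (simp_all add: binding_prefix_def)
  have "sat T (quantify q (bind b \<phi>)) Map.empty t \<longleftrightarrow> sat G (quantify q (bind b \<phi>)) Map.empty (unw t)" for t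
  proof (cases "free \<phi> = {}")
    case True
    \<comment> \<open>A closed body leaves no variable to quantify and hence no game. It is
      evaluated at a single state, for which a constant path suffices.\<close>
    then have "q = []" using "8.hyps" by (simp add: quantification_prefix_def free_bind_sentence)
    moreover have "sat T \<phi> \<chi> t \<longleftrightarrow> sat G \<phi> \<chi>' (unw t)" for \<chi> \<chi>'
      using sat_iff_lsat_sentence[OF "8.hyps"(1) True, of T \<chi> "\<lambda>_. t" 0]
        sat_iff_lsat_sentence[OF "8.hyps"(1) True, of G \<chi>' "\<lambda>_. unw t" 0] "8.IH"[of "\<lambda>_. t" 0]
      by (simp add: comp_def)
    ultimately show ?thesis by (simp add: quantify_def sat_bind[OF db])
  next
    case False
    then have "free (bind b \<phi>) = Inl ` snd ` set b" 
      using ogsl_free[OF "8.hyps"(1)] free_bind[OF db, of \<phi>] all by simp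
    then have dist: "distinct (map qvar q)" and vars: "snd ` set b = set (map qvar q)"
      using "8.hyps" by (auto simp: quantification_prefix_def)
    let ?n = "length q"
    let ?st = "\<lambda>H. states H (decision_of q b) ?n"
    have "b \<noteq> []" using all by auto
    then have n: "?n > 0" using vars by auto
    have "?st G (unw t) \<alpha> k = unw (?st T t \<alpha> k)" for \<alpha> k
      using unw by (induction k) (simp_all add: unwinding_map_def)
    then have "?st G (unw t) \<alpha> = unw \<circ> ?st T t \<alpha>" for \<alpha> by auto
    then have lsat: "lsat T \<phi> (?st T t \<alpha>) 0 \<longleftrightarrow> lsat G \<phi> (?st G (unw t) \<alpha>) 0" for \<alpha>
      using "8.IH" by (simp add: comp_def)
    have "\<exists>v \<sigma>. \<forall>\<alpha>. (\<forall>k. is_ex (q ! (k mod ?n)) = v \<longrightarrow> \<alpha> k = \<sigma> (pre \<alpha> k)) \<longrightarrow>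
        lsat G \<phi> (?st G (unw t) \<alpha>) 0 = v"
      using lsat_game_determined[OF n, of "\<lambda>u. is_ex (q ! (length u mod ?n))" G \<phi> "decision_of q b" "unw t"]
      by simp metis
    then obtain v \<sigma> where \<sigma>: "\<And>\<alpha>. (\<And>k. is_ex (q ! (k mod ?n)) = v \<Longrightarrow> \<alpha> k = \<sigma> (pre \<alpha> k)) \<Longrightarrow>
        lsat G \<phi> (?st G (unw t) \<alpha>) 0 = v" by metis
    have "sat G (quantify q (bind b \<phi>)) Map.empty (unw t) = v"
      by (rule sat_block_value[OF "8.hyps"(1,2) dist vars \<sigma>])
    moreover have "sat T (quantify q (bind b \<phi>)) Map.empty t = v"
    proof (rule sat_block_value[OF "8.hyps"(1,2) dist vars, where \<sigma> = \<sigma>])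
      fix \<alpha> assume "\<And>k. is_ex (q ! (k mod ?n)) = v \<Longrightarrow> \<alpha> k = \<sigma> (pre \<alpha> k)"
      then show "lsat T \<phi> (?st T t \<alpha>) 0 = v" unfolding lsat by (rule \<sigma>)
    qed
    ultimately show ?thesis by simp
  qed
  then show ?case using "8.hyps" by (simp add: lsat_block)
qed simp_all

theorem mainTheorem5:
  fixes \<phi> :: "('ap::finite, 'ag::finite, 'v) sl"
    and G :: "('ap, 'ag, 'ac::countable, 'st::countable) cgs"
    and G\<^sub>D\<^sub>U :: "('ap, 'ag, 'ac, ('ag, 'ac) decision list) cgs"
  assumes "ogsl_sentence \<phi>"
    and "decision_unwinding G G\<^sub>D\<^sub>U"
  shows "G \<Turnstile> \<phi> \<longleftrightarrow> G\<^sub>D\<^sub>U \<Turnstile> \<phi>"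
proof -
  obtain unw where unw: "unwinding_map G G\<^sub>D\<^sub>U unw"
    using assms(2) by (auto simp: decision_unwinding_def)
  then have init: "init G\<^sub>D\<^sub>U = []" "unw [] = init G"
    using assms(2) by (simp_all add: decision_unwinding_def decision_tree_def unwinding_map_def)
  have \<phi>: "ogsl \<phi>" "free \<phi> = {}" using assms(1) by (auto simp: ogsl_sentence_def sentence_def)
  \<comment> \<open>A closed formula looks at the initial state only, so constant paths link the two
    structures.\<close>
  show ?thesis
    using lsat_unwinding[OF unw \<phi>(1), of "\<lambda>_. []" 0] sat_iff_lsat_sentence[OF \<phi>, of G Map.empty "\<lambda>_. init G" 0]
      sat_iff_lsat_sentence[OF \<phi>, of G\<^sub>D\<^sub>U Map.empty "\<lambda>_. []" 0] init
    by (simp add: models_def comp_def)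
qed

end
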